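(* Let $P$ be a fixed probability distribution on the positive integers. For each positive integer $n$, let $T_n$ be an arbitrary reflexive tree on $n$ vertices, and let $\phi:E(T_n)\to\mathbb{Z}$ be random, each edge (including each loop) independently receiving a positive integer distributed according to $P$. Let $A_n$ be the event that there exists $N$ such that for every prime $p\ge N$ the lift $T_n^\sigma$ is Hamiltonian. Then $\Pr(A_n)\to 1$ as $n\to\infty$ (for every choice of the trees $T_n$).
   Context: A reflexive tree has exactly one loop at each vertex. For a prime $p$, $\sigma$ is the voltage assignment into $\mathbb{Z}_p$ obtained by orienting each edge $e$ (arcs $e^+,e^-$; for loops the primary and secondary arcs) and setting $\sigma(e^+)=\phi(e)\bmod p$, $\sigma(e^-)=-\phi(e)\bmod p$. The lift $T^\sigma$ has vertex set $V(T)\times\mathbb{Z}_p$, with $(x,a)$ adjacent to $(y,b)$ iff some arc $(x,y)$ has $\sigma(x,y)=b-a$. *)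

theory Defs
  imports "HOL-Probability.Probability" "HOL-Computational_Algebra.Primes"
begin

text \<open>
  Cycles are lists of distinct vertices, of length at least 3, read cyclically. The same notion is
  used for the absence of cycles in a tree and for Hamilton cycles in a lift; loops of the
  adjacency relation never contribute to a cycle.
\<close>

definition is_cycle :: "('v \<Rightarrow> 'v \<Rightarrow> bool) \<Rightarrow> 'v list \<Rightarrow> bool" where
  "is_cycle adj c \<longleftrightarrow> length c \<ge> 3 \<and> distinct c \<and>
     (\<forall>i<length c. adj (c ! i) (c ! (Suc i mod length c)))"

definition hamiltonian :: "'v set \<Rightarrow> ('v \<Rightarrow> 'v \<Rightarrow> bool) \<Rightarrow> bool" where
  "hamiltonian V adj \<longleftrightarrow> (\<exists>c. is_cycle adj c \<and> set c = V)"

text \<open>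
  An edge is the set of its end points: \<open>{x, y}\<close> with \<open>x \<noteq> y\<close> is a proper edge, \<open>{x}\<close> is the
  loop at \<open>x\<close>. There are no parallel edges in this encoding, hence at most one loop at each vertex.
\<close>

definition reflexive_tree :: "'a set \<Rightarrow> 'a set set \<Rightarrow> bool" where
  "reflexive_tree V E \<longleftrightarrow>
     finite V \<and> V \<noteq> {} \<and>
     E \<subseteq> {{x, y} | x y. x \<in> V \<and> y \<in> V} \<and>
     (\<forall>x\<in>V. {x} \<in> E) \<and>
     (\<forall>x\<in>V. \<forall>y\<in>V. (x, y) \<in> {(u, v). {u, v} \<in> E}\<^sup>*) \<and>
     (\<nexists>c. is_cycle (\<lambda>u v. {u, v} \<in> E) c)"

text \<open>An orientation assigns to every edge the pair (tail, head) of its positive arc.\<close>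

definition orientation :: "'a set set \<Rightarrow> ('a set \<Rightarrow> 'a \<times> 'a) \<Rightarrow> bool" where
  "orientation E ori \<longleftrightarrow> (\<forall>e\<in>E. e = {fst (ori e), snd (ori e)})"

text \<open>
  \<open>Pos e\<close> and \<open>Neg e\<close> are the arcs \<open>e\<^sup>+\<close> and \<open>e\<^sup>-\<close>; for a loop they are the primary and the
  secondary arc, two distinct arcs with the same tail and head.
\<close>

datatype 'e arc = Pos 'e | Neg 'e

fun arc_ends :: "('e \<Rightarrow> 'a \<times> 'a) \<Rightarrow> 'e arc \<Rightarrow> 'a \<times> 'a" where
  "arc_ends ori (Pos e) = (fst (ori e), snd (ori e))"
| "arc_ends ori (Neg e) = (snd (ori e), fst (ori e))"

definition arcs_of :: "'e set \<Rightarrow> 'e arc set" where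
  "arcs_of E = Pos ` E \<union> Neg ` E"

text \<open>The group of integers modulo \<open>p\<close> is represented by the residues \<open>{0..<int p}\<close>.\<close>

fun voltage :: "nat \<Rightarrow> ('e \<Rightarrow> int) \<Rightarrow> 'e arc \<Rightarrow> int" where
  "voltage p \<phi> (Pos e) = \<phi> e mod int p"
| "voltage p \<phi> (Neg e) = (- \<phi> e) mod int p"

definition lift_verts :: "nat \<Rightarrow> 'a set \<Rightarrow> ('a \<times> int) set" where
  "lift_verts p V = V \<times> {0..<int p}"

definition lift_adj ::
  "nat \<Rightarrow> 'e set \<Rightarrow> ('e \<Rightarrow> 'a \<times> 'a) \<Rightarrow> ('e arc \<Rightarrow> int) \<Rightarrow> 'a \<times> int \<Rightarrow> 'a \<times> int \<Rightarrow> bool" where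
  "lift_adj p E ori \<sigma> u v \<longleftrightarrow>
     (\<exists>\<alpha>\<in>arcs_of E. arc_ends ori \<alpha> = (fst u, fst v) \<and> \<sigma> \<alpha> = (snd v - snd u) mod int p)"

text \<open>
  The law of a random labelling of the finite edge set \<open>E\<close> with independent labels of law \<open>P\<close>.
  The value 0 outside of \<open>E\<close> is a dummy.
\<close>

definition random_labelling :: "'e set \<Rightarrow> int pmf \<Rightarrow> ('e \<Rightarrow> int) pmf" where
  "random_labelling E P = Pi_pmf E 0 (\<lambda>_. P)"

end

theory Submission
  imports Defs
begin

text \<open>
  A potential along a spanning tree turns the voltages of the tree edges into \<open>0\<close>. The lift then
  consists of one \<open>p\<close>-cycle (layer) for each vertex, whose step is the label of the loop, and of
  perfect matchings between the layers of neighbouring vertices. Let \<open>x\<close>, \<open>y\<close> be neighbours with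
  steps \<open>t \<noteq> s\<close>. Replacing the edges \<open>a, a + t\<close> and \<open>a + s, a + s + t\<close> of the layer \<open>x\<close> by the two
  paths into which the layer \<open>y\<close> decomposes attaches that layer to a cycle. If the cycle runs
  through both edges in the same direction, it falls into two cycles, and both contain parts of \<open>x\<close>
  and of \<open>y\<close>; attaching another vertex to \<open>x\<close> or \<open>y\<close> at an edge of each of the two cycles joins them
  again. If the directions are opposite, there remains one cycle, and \<open>x\<close> is now traversed in both
  directions. In this way vertices can be attached in pairs, namely two leaves with the same
  neighbour or a path with two vertices. All changes take place in a window of bounded length, so
  that for large \<open>p\<close> another window stays untouched and the procedure can be repeated.

  An edge with equal labels at its ends provides the starting point for either parity of the
  number of vertices, since the layers of its ends can be merged along a square. Such an edge
  exists with probability tending to \<open>1\<close>.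
\<close>

section \<open>Surgery on cyclic lists\<close>

text \<open>Whether attaching a layer splits the cycle depends on directions over which there is no
  control. This is why vertices come in pairs, and why the inductive claim says nothing about
  directions, only that no edge of a layer is missing in a low window. Each pair uses up a window
  whose length is polynomial in the largest label, whatever \<open>p\<close> is; the tree being
  finite, everything fits below \<open>p\<close> once \<open>p\<close> is large, which yields the
  \<open>N\<close> of the event. Primality makes every layer a single cycle, since each step
  \<open>0 < t < p\<close> generates the group; \<open>p > 2\<close> keeps a layer edge from
  coinciding with its reverse. Pairs are peeled off at the deepest level until only the root edge
  and at most one further neighbour of each of its ends remain. If both neighbours are left, they
  form neither kind of pair; this path with four vertices needs a construction of its own, which
  again relies on the equal labels. A star shows what the probability estimate has to handle: all
  comparisons share the label of the centre, so they are not independent, and only the conditional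
  probability given that label is a power.\<close>

definition arcs :: "'v list \<Rightarrow> ('v \<times> 'v) set" where
  "arcs w = set (zip w (tl w))"

definition carcs :: "'v list \<Rightarrow> ('v \<times> 'v) set" where
  "carcs w = insert (last w, hd w) (arcs w)"

definition links :: "'v list \<Rightarrow> ('v \<times> 'v) set" where
  "links w = carcs w \<union> (carcs w)\<inverse>"

lemma arcs_Nil [simp]: "arcs [] = {}" and arcs_single [simp]: "arcs [u] = {}"
  by (simp_all add: arcs_def)

lemma arcs_Cons: "w \<noteq> [] \<Longrightarrow> arcs (u # w) = insert (u, hd w) (arcs w)"
  by (cases w) (simp_all add: arcs_def)

lemma arcs_append [simp]:
  "v \<noteq> [] \<Longrightarrow> w \<noteq> [] \<Longrightarrow> arcs (v @ w) = insert (last v, hd w) (arcs v \<union> arcs w)"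
proof (induction v)
  case (Cons u v)
  then show ?case by (cases "v = []") (auto simp: arcs_Cons)
qed simp

lemma arcs_rev [simp]: "arcs (rev w) = (arcs w)\<inverse>"
proof (induction w)
  case (Cons u w)
  then show ?case by (cases "w = []") (auto simp: arcs_Cons last_rev)
qed simp

lemma carcs_rev [simp]: "w \<noteq> [] \<Longrightarrow> carcs (rev w) = (carcs w)\<inverse>"
  by (auto simp: carcs_def last_rev hd_rev)

lemma links_rev [simp]: "w \<noteq> [] \<Longrightarrow> links (rev w) = links w"
  by (auto simp: links_def)

lemma links_sym: "(u, v) \<in> links w \<Longrightarrow> (v, u) \<in> links w"
  by (auto simp: links_def)

lemma arcs_set: "(u, v) \<in> arcs w \<Longrightarrow> u \<in> set w \<and> v \<in> set w"
  by (auto simp: arcs_def dest: set_zip_leftD set_zip_rightD intro: list.set_sel(2))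

lemma arcs_avoid:
  "u \<notin> set w \<Longrightarrow> (u, v) \<notin> arcs w" "v \<notin> set w \<Longrightarrow> (u, v) \<notin> arcs w"
  using arcs_set by metis+

lemma carcs_set: "w \<noteq> [] \<Longrightarrow> (u, v) \<in> carcs w \<Longrightarrow> u \<in> set w \<and> v \<in> set w"
  by (auto simp: carcs_def dest: arcs_set)

lemma links_set: "w \<noteq> [] \<Longrightarrow> (u, v) \<in> links w \<Longrightarrow> u \<in> set w \<and> v \<in> set w"
  by (auto simp: links_def dest: carcs_set)

lemma arcs_split:
  assumes "(u, v) \<in> arcs w"
  obtains P Q where "w = P @ Q" "P \<noteq> []" "Q \<noteq> []" "last P = u" "hd Q = v"
proof -
  have "\<exists>P Q. w = P @ Q \<and> P \<noteq> [] \<and> Q \<noteq> [] \<and> last P = u \<and> hd Q = v"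
    using assms
  proof (induction w)
    case (Cons a w)
    then have ne: "w \<noteq> []" by auto
    show ?case
    proof (cases "(u, v) \<in> arcs w")
      case True
      with Cons obtain P Q where "w = P @ Q" "P \<noteq> []" "Q \<noteq> []" "last P = u" "hd Q = v"
        by blast
      then show ?thesis by (intro exI[of _ "a # P"] exI[of _ Q]) auto
    next
      case False
      with Cons.prems ne have "u = a" "v = hd w" by (auto simp: arcs_Cons)
      with ne show ?thesis by (intro exI[of _ "[a]"] exI[of _ w]) auto
    qed
  qed simp
  then show thesis using that by blast
qed

text \<open>Rotation turns the chosen arc into the wrap-around arc, so that deleting it leaves a
  path given by a plain list.\<close>

lemma carcs_rotate:
  assumes "(u, v) \<in> carcs w" "w \<noteq> []"
  obtains w' where "w' \<noteq> []" "set w' = set w" "distinct w' = distinct w"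
    "hd w' = v" "last w' = u" "carcs w' = carcs w"
proof (cases "(u, v) \<in> arcs w")
  case True
  then obtain P Q where *: "w = P @ Q" "P \<noteq> []" "Q \<noteq> []" "last P = u" "hd Q = v"
    by (rule arcs_split)
  show thesis
    by (rule that[of "Q @ P"]) (use * in \<open>auto simp: carcs_def\<close>)
next
  case False
  with assms show thesis by (intro that[of w]) (auto simp: carcs_def)
qed

lemma arcs_last_notin: "distinct w \<Longrightarrow> (last w, v) \<notin> arcs w"
proof
  assume "distinct w" "(last w, v) \<in> arcs w"
  then show False by (elim arcs_split) (auto dest: last_in_set)
qed

lemma carcs_succ_unique:
  assumes "distinct w" "w \<noteq> []" "(u, v) \<in> carcs w" "(u, v') \<in> carcs w"
  shows "v' = v"
proof -
  obtain w' where w': "w' \<noteq> []" "distinct w' = distinct w" "hd w' = v" "last w' = u" "carcs w' = carcs w"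
    using carcs_rotate[OF assms(3,2)] by metis
  then have "(u, v') \<in> carcs w'" "(u, v') \<notin> arcs w'"
    using assms arcs_last_notin[of w'] by auto
  with w' show ?thesis by (auto simp: carcs_def)
qed

lemma carcs_pred_unique:
  assumes "distinct w" "w \<noteq> []" "(u, v) \<in> carcs w" "(u', v) \<in> carcs w"
  shows "u' = u"
  using carcs_succ_unique[of "rev w" v u u'] assms by auto

text \<open>There is no lower bound on the length: the surgery never has to count vertices, and the
  bound 3 of \<open>is_cycle\<close> is recovered at the very end from the size of the
  layers.\<close>

definition cyc :: "('v \<times> 'v) set \<Rightarrow> 'v list \<Rightarrow> bool" where
  "cyc G w \<longleftrightarrow> distinct w \<and> w \<noteq> [] \<and> carcs w \<subseteq> G"

lemma cyc_rev: "sym G \<Longrightarrow> cyc G w \<Longrightarrow> cyc G (rev w)"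
  by (auto simp: cyc_def sym_def)

lemma cyc_orient:
  assumes "sym G" "cyc G w" "(u, v) \<in> links w"
  obtains w' where "cyc G w'" "set w' = set w" "links w' = links w" "(u, v) \<in> carcs w'"
proof (cases "(u, v) \<in> carcs w")
  case True
  with assms that[of w] show thesis by auto
next
  case False
  with assms have "(u, v) \<in> carcs (rev w)" "w \<noteq> []" by (auto simp: links_def cyc_def)
  with assms that[of "rev w"] cyc_rev show thesis by force
qed

lemma cyc_open:
  assumes "cyc G w" "(u, v) \<in> carcs w"
  obtains P where "P \<noteq> []" "distinct P" "set P = set w" "hd P = v" "last P = u"
    "arcs P \<subseteq> G" "carcs w = insert (u, v) (arcs P)"
proof -
  obtain P where P: "P \<noteq> []" "set P = set w" "distinct P = distinct w" "hd P = v" "last P = u"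
     "carcs P = carcs w" using carcs_rotate[OF assms(2)] assms(1) unfolding cyc_def by metis
  have eq: "carcs w = insert (u, v) (arcs P)"
    using P(6) by (simp add: carcs_def[of P] P(4,5))
  have "arcs P \<subseteq> G" "distinct P" using assms(1) P(3) by (auto simp: cyc_def eq)
  then show thesis using P(1,2,4,5) eq by (intro that[of P])
qed

text \<open>A vertex of a cycle has only one successor, so \<open>u' \<noteq> u\<close> is enough to
  keep the two arcs apart. How \<open>P\<close> and \<open>Q\<close> pair the four ends decides
  whether a later reconnection gives one cycle or two.\<close>

lemma cyc_cut:
  assumes "cyc G w" "(u, v) \<in> carcs w" "(u', v') \<in> carcs w" "u' \<noteq> u"
  obtains P Q where "P \<noteq> []" "Q \<noteq> []" "distinct P" "distinct Q" "set P \<inter> set Q = {}"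
    "set w = set P \<union> set Q" "hd P = v" "last P = u'" "hd Q = v'" "last Q = u"
    "arcs P \<subseteq> G" "arcs Q \<subseteq> G" "carcs w = insert (u, v) (insert (u', v') (arcs P \<union> arcs Q))"
proof -
  obtain w' where w': "w' \<noteq> []" "distinct w'" "set w' = set w" "hd w' = v" "last w' = u"
    "arcs w' \<subseteq> G" "carcs w = insert (u, v) (arcs w')"
    using cyc_open[OF assms(1,2)] .
  then have "(u', v') \<in> arcs w'" using assms by auto
  then obtain P Q where *: "w' = P @ Q" "P \<noteq> []" "Q \<noteq> []" "last P = u'" "hd Q = v'"
    by (rule arcs_split)
  show thesis
    by (rule that[of P Q]) (use * w' in auto)
qed

text \<open>Either cycle may be reversed beforehand. They are opened so that \<open>(u, u')\<close>
  and \<open>(v', v)\<close> are the deleted arcs; the other two sides of the square then close up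
  the two paths.\<close>

lemma cyc_merge:
  assumes "sym G" "cyc G C" "cyc G D" "set C \<inter> set D = {}"
    and "(u, u') \<in> links C" "(v, v') \<in> links D" "(u, v) \<in> G" "(u', v') \<in> G"
  obtains w where "cyc G w" "set w = set C \<union> set D"
    "links C - {(u, u'), (u', u)} \<subseteq> links w" "links D - {(v, v'), (v', v)} \<subseteq> links w"
proof -
  obtain C' where C': "cyc G C'" "set C' = set C" "links C' = links C" "(u, u') \<in> carcs C'"
    using cyc_orient[OF assms(1,2,5)] .
  obtain D' where D': "cyc G D'" "set D' = set D" "links D' = links D" "(v', v) \<in> carcs D'"
    using cyc_orient[OF assms(1,3) links_sym[OF assms(6)]] .
  obtain P where P: "P \<noteq> []" "distinct P" "set P = set C'" "hd P = u'" "last P = u"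
     "arcs P \<subseteq> G" "carcs C' = insert (u, u') (arcs P)" using cyc_open[OF C'(1,4)] .
  obtain Q where Q: "Q \<noteq> []" "distinct Q" "set Q = set D'" "hd Q = v" "last Q = v'"
     "arcs Q \<subseteq> G" "carcs D' = insert (v', v) (arcs Q)" using cyc_open[OF D'(1,4)] .
  have "(v', u') \<in> G" using assms by (auto simp: sym_def)
  then have "carcs (P @ Q) \<subseteq> G" using P Q assms(7) by (auto simp: carcs_def)
  moreover have "distinct (P @ Q)" using P Q C'(2) D'(2) assms(4) by auto
  ultimately have "cyc G (P @ Q)" using P(1) by (simp add: cyc_def)
  moreover have "set (P @ Q) = set C \<union> set D" using P(3) Q(3) C'(2) D'(2) by simp
  moreover have "links C - {(u, u'), (u', u)} \<subseteq> links (P @ Q)"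
    unfolding C'(3)[symmetric] using P(1,7) Q(1) by (auto simp: links_def carcs_def)
  moreover have "links D - {(v, v'), (v', v)} \<subseteq> links (P @ Q)"
    unfolding D'(3)[symmetric] using P(1) Q(1,7) by (auto simp: links_def carcs_def)
  ultimately show thesis by (rule that)
qed

section \<open>Attaching layers to a cycle\<close>

text \<open>
  The offset between the two edges of a layer with step \<open>t\<close> at which a layer with step \<open>s\<close>
  gets attached. Equal steps would admit any offset that is not adjacent to \<open>0\<close>.
\<close>

definition off :: "int \<Rightarrow> int \<Rightarrow> int" where
  "off t s = (if s = t then 2 * t else s)"

section \<open>The normalised lift and its layers\<close>

locale voltage_lift =
  fixes p :: nat and l :: "'a \<Rightarrow> int" and nb :: "'a \<Rightarrow> 'a \<Rightarrow> bool"
  assumes prime_p: "prime p" and p_gt_2: "p > 2"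
    and l_pos: "0 < l v" and l_less: "l v < int p"
    and nb_sym: "nb u v \<Longrightarrow> nb v u"
begin

text \<open>Indices stay arbitrary integers and are reduced only here, so that heights can be
  compared and added in \<int> while equality of vertices is congruence.\<close>

definition pt :: "'a \<Rightarrow> int \<Rightarrow> 'a \<times> int" where
  "pt v i = (v, i mod int p)"

definition G :: "(('a \<times> int) \<times> ('a \<times> int)) set" where
  "G = {(pt v i, pt v (i + l v)) | v i. True} \<union> {(pt v (i + l v), pt v i) | v i. True}
     \<union> {(pt u i, pt v i) | u v i. nb u v}"

definition layer :: "'a \<Rightarrow> ('a \<times> int) set" where
  "layer v = {v} \<times> {0..<int p}"

definition has :: "('a \<times> int) list \<Rightarrow> 'a \<Rightarrow> int \<Rightarrow> bool" where
  "has C v i \<longleftrightarrow> (pt v i, pt v (i + l v)) \<in> links C"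

lemma sym_G: "sym G"
  unfolding G_def sym_def using nb_sym by blast

lemma G_step [simp]: "(pt v i, pt v (i + l v)) \<in> G" "(pt v (i + l v), pt v i) \<in> G"
  by (auto simp: G_def)

lemma G_rung: "nb u v \<Longrightarrow> (pt u i, pt v i) \<in> G" "nb u v \<Longrightarrow> (pt v i, pt u i) \<in> G"
  unfolding G_def using nb_sym by blast+

lemma pt_eq_iff: "pt u i = pt v j \<longleftrightarrow> u = v \<and> int p dvd (i - j)"
  by (auto simp: pt_def mod_eq_dvd_iff)

lemma pt_add_cancel [simp]: "pt v (i + k) = pt v (j + k) \<longleftrightarrow> pt v i = pt v j"
  by (simp add: pt_eq_iff)

lemma pt_in_layer [simp]: "pt u i \<in> layer v \<longleftrightarrow> u = v"
  using p_gt_2 by (auto simp: pt_def layer_def)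

lemma layer_pt: "z \<in> layer v \<Longrightarrow> \<exists>i. z = pt v i"
  by (auto simp: layer_def pt_def intro!: exI[of _ "snd z"])

lemma not_dvd_small: "0 < k \<Longrightarrow> k < int p \<Longrightarrow> \<not> int p dvd k"
  using zdvd_not_zless by blast

lemma not_dvd_double: "0 < k \<Longrightarrow> k < int p \<Longrightarrow> \<not> int p dvd 2 * k"
proof
  assume k: "0 < k" "k < int p" and "int p dvd 2 * k"
  with prime_p have "int p dvd 2 \<or> int p dvd k"
    by (meson prime_dvd_mult_iff prime_nat_int_transfer)
  with k not_dvd_small[of k] not_dvd_small[of 2] p_gt_2 show False by auto
qed

lemma off_not_dvd: "\<not> int p dvd off (l u) (l v)"
  using not_dvd_small[of "l v"] not_dvd_double[of "l v"] l_pos[of v] l_less[of v]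
  by (auto simp: off_def)

lemma pt_off_ne [simp]: "pt w (i + off (l u) (l v)) \<noteq> pt w i"
  using off_not_dvd[of u v] by (simp add: pt_eq_iff)

lemma pt_step_ne [simp]: "pt w (i + l u) \<noteq> pt w i"
  using not_dvd_small[of "l u"] l_pos[of u] l_less[of u] by (simp add: pt_eq_iff)

lemma step_eq: "pt v i = pt x a \<Longrightarrow> pt v (i + l v) = pt x (a + l x) \<Longrightarrow> v = x \<and> pt x i = pt x a"
  by (simp add: pt_eq_iff)

text \<open>Equality would force \<open>p\<close> to divide \<open>2 * l x\<close>. Together with
  \<open>step_eq\<close> this gives every layer edge a single index modulo \<open>p\<close>,
  whichever way it is traversed, so that removing one index removes one edge.\<close>

lemma step_ne: "pt v i = pt x (a + l x) \<Longrightarrow> pt v (i + l v) \<noteq> pt x a"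
proof
  assume "pt v i = pt x (a + l x)" "pt v (i + l v) = pt x a"
  then have "v = x" and *: "int p dvd i - (a + l x)" "int p dvd i + l x - a"
    by (auto simp: pt_eq_iff)
  from dvd_diff[OF *(2,1)] have "int p dvd 2 * l x" by (simp add: algebra_simps)
  then show False using not_dvd_double l_pos l_less by blast
qed

definition fibre :: "'a \<Rightarrow> ('a \<times> int) list" where
  "fibre v = map (\<lambda>k. pt v (int k * l v)) [0..<p]"

text \<open>As \<open>p\<close> is prime, the step is invertible modulo \<open>p\<close>, and its
  multiples run through all residues before repeating.\<close>

lemma distinct_fibre: "distinct (fibre v)"
proof -
  have "j = k" if "j < p" "k < p" "int p dvd int j * l v - int k * l v" for j k
  proof -
    have "int p dvd (int j - int k) * l v" using that by (simp add: algebra_simps)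
    with prime_p have "int p dvd (int j - int k) \<or> int p dvd l v"
      by (meson prime_dvd_mult_iff prime_nat_int_transfer)
    with not_dvd_small[of "l v"] l_pos l_less have "int p dvd (int j - int k)" by blast
    with that show ?thesis
      using dvd_imp_le_int[of "int j - int k" "int p"] by fastforce
  qed
  then show ?thesis
    by (auto simp: fibre_def distinct_map inj_on_def pt_eq_iff)
qed

lemma set_fibre: "set (fibre v) = layer v"
proof (rule card_subset_eq)
  show "finite (layer v)" by (simp add: layer_def)
  show "set (fibre v) \<subseteq> layer v" by (auto simp: fibre_def)
  show "card (set (fibre v)) = card (layer v)"
    using distinct_card[OF distinct_fibre, of v]
    by (simp add: layer_def fibre_def card_cartesian_product)
qed

lemma fibre_step: "(pt v i, pt v (i + l v)) \<in> carcs (fibre v)"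
proof -
  have "pt v i \<in> set (fibre v)" by (simp add: set_fibre)
  then obtain k where k: "k < p" "pt v i = pt v (int k * l v)" by (auto simp: fibre_def)
  then have k': "pt v (i + l v) = pt v (int (Suc k) * l v)"
    by (auto simp: pt_eq_iff algebra_simps)
  show ?thesis
  proof (cases "Suc k < p")
    case True
    have "zip (fibre v) (tl (fibre v)) ! k = (pt v (int k * l v), pt v (int (Suc k) * l v))"
      "k < length (zip (fibre v) (tl (fibre v)))"
      using True by (simp_all add: fibre_def nth_tl)
    then have "(pt v (int k * l v), pt v (int (Suc k) * l v)) \<in> arcs (fibre v)"
      unfolding arcs_def by (metis nth_mem)
    then show ?thesis using k k' by (simp add: carcs_def)
  next
    case False
    then have "Suc k = p" using k by simp
    then have "last (fibre v) = pt v (int k * l v)" "hd (fibre v) = pt v 0"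
      by (auto simp: fibre_def hd_map last_map last_upt)
    moreover have "pt v (int (Suc k) * l v) = pt v 0"
      unfolding \<open>Suc k = p\<close> by (simp add: pt_eq_iff)
    ultimately show ?thesis using k k' by (simp add: carcs_def)
  qed
qed

lemma carcs_fibre: "carcs (fibre v) = range (\<lambda>i. (pt v i, pt v (i + l v)))"
proof (intro subset_antisym subsetI)
  fix e assume e: "e \<in> carcs (fibre v)"
  obtain z z' where [simp]: "e = (z, z')" by (cases e)
  have ne: "fibre v \<noteq> []" using p_gt_2 by (simp add: fibre_def)
  with e have "z \<in> layer v" using carcs_set set_fibre by fastforce
  then obtain i where i: "z = pt v i" using layer_pt by blast
  have "z' = pt v (i + l v)"
    by (rule carcs_succ_unique[OF distinct_fibre ne fibre_step]) (use e i in simp)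
  with i show "e \<in> range (\<lambda>i. (pt v i, pt v (i + l v)))" by simp
qed (auto intro: fibre_step)

lemma cyc_fibre: "cyc G (fibre v)"
  using distinct_fibre p_gt_2 by (auto simp: cyc_def carcs_fibre) (simp add: fibre_def)

lemma has_fibre [simp]: "has (fibre v) v i"
  by (auto simp: has_def links_def carcs_fibre)

text \<open>The offsets of the two layers are matched: cutting the layer \<open>y\<close> at
  \<open>a\<close> and \<open>a + off (l y) (l x)\<close> frees the same four indices
  \<open>a\<close>, \<open>a + t\<close>, \<open>a + d\<close>, \<open>a + d + t\<close> as cutting
  the layer \<open>x\<close> at \<open>a\<close> and \<open>a + d\<close>. For different steps they
  form a parallelogram, whose two pairs of parallel sides belong to the two layers; for equal steps
  they are four consecutive vertices. The last conclusion, about directions, is restricted to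
  different steps because otherwise one of the pieces gets reversed.\<close>

lemma split_fibre:
  fixes x y a
  defines "t \<equiv> l x" and "d \<equiv> off (l x) (l y)"
  obtains Y Z where "Y \<noteq> []" "Z \<noteq> []" "distinct Y" "distinct Z" "set Y \<inter> set Z = {}"
    "set Y \<union> set Z = layer y" "arcs Y \<subseteq> G" "arcs Z \<subseteq> G"
    "hd Y = pt y (a + d)" "last Y = pt y (a + t)" "hd Z = pt y (a + d + t)" "last Z = pt y a"
    "\<And>i. pt y i \<noteq> pt y a \<Longrightarrow> pt y i \<noteq> pt y (a + off (l y) (l x)) \<Longrightarrow>
       (pt y i, pt y (i + l y)) \<in> (arcs Y \<union> arcs Z) \<union> (arcs Y \<union> arcs Z)\<inverse>"
    "\<And>i. l x \<noteq> l y \<Longrightarrow> pt y i \<noteq> pt y a \<Longrightarrow> pt y i \<noteq> pt y (a + l x) \<Longrightarrow>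
       (pt y i, pt y (i + l y)) \<in> arcs Y \<union> arcs Z"
proof -
  define e where "e = off (l y) (l x)"
  have ne: "pt y (a + e) \<noteq> pt y a" by (simp add: e_def)
  obtain P Q where PQ: "P \<noteq> []" "Q \<noteq> []" "distinct P" "distinct Q" "set P \<inter> set Q = {}"
    "set (fibre y) = set P \<union> set Q" "hd P = pt y (a + l y)" "last P = pt y (a + e)"
    "hd Q = pt y (a + e + l y)" "last Q = pt y a" "arcs P \<subseteq> G" "arcs Q \<subseteq> G"
    "carcs (fibre y) = insert (pt y a, pt y (a + l y))
       (insert (pt y (a + e), pt y (a + e + l y)) (arcs P \<union> arcs Q))"
    by (rule cyc_cut[OF cyc_fibre fibre_step fibre_step ne])
  have edge: "(pt y i, pt y (i + l y)) \<in> arcs P \<union> arcs Q"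
    if "pt y i \<noteq> pt y a" "pt y i \<noteq> pt y (a + e)" for i
    using fibre_step[of y i] that unfolding PQ(13) by auto
  show thesis
  proof (cases "l x = l y")
    case True
    then have de: "e = 2 * l x" "d = 2 * l x" by (simp_all add: e_def off_def d_def)
    show thesis
    \<comment> \<open>With equal steps \<open>P\<close> runs from \<open>a + t\<close> to
      \<open>a + 2 * t = a + d\<close>, against the direction required of \<open>Y\<close>.\<close>
    proof (rule that[of "rev P" Q])
      show "arcs (rev P) \<subseteq> G" using PQ(11) sym_G by (auto simp: sym_def)
      show "set (rev P) \<union> set Q = layer y" using PQ(6) by (simp add: set_fibre)
      show "hd Q = pt y (a + d + t)" using PQ(9) True unfolding de t_def by simp
      show "hd (rev P) = pt y (a + d)" using PQ(1,8) unfolding de by (simp add: hd_rev)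
      show "last (rev P) = pt y (a + t)" using PQ(1,7) True unfolding t_def by (simp add: last_rev)
      fix i assume "pt y i \<noteq> pt y a" "pt y i \<noteq> pt y (a + off (l y) (l x))"
      then show "(pt y i, pt y (i + l y)) \<in> (arcs (rev P) \<union> arcs Q) \<union> (arcs (rev P) \<union> arcs Q)\<inverse>"
        using edge[of i] unfolding e_def arcs_rev by blast
    qed (use PQ True in simp_all)
  next
    case False
    then have de: "e = l x" "d = l y" by (simp_all add: e_def off_def d_def)
    show thesis
    proof (rule that[of P Q])
      show "set P \<union> set Q = layer y" using PQ(6) by (simp add: set_fibre)
      show "hd P = pt y (a + d)" using PQ(7) unfolding de .
      show "last P = pt y (a + t)" using PQ(8) unfolding de t_def .
      show "hd Q = pt y (a + d + t)" using PQ(9) unfolding de t_def by (simp add: add_ac)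
    next
      fix i assume "pt y i \<noteq> pt y a" "pt y i \<noteq> pt y (a + off (l y) (l x))"
      then show "(pt y i, pt y (i + l y)) \<in> (arcs P \<union> arcs Q) \<union> (arcs P \<union> arcs Q)\<inverse>"
        using edge[of i] unfolding e_def by blast
    next
      fix i assume "pt y i \<noteq> pt y a" "pt y i \<noteq> pt y (a + l x)"
      then show "(pt y i, pt y (i + l y)) \<in> arcs P \<union> arcs Q"
        using edge[of i] unfolding de by blast
    qed (use PQ in simp_all)
  qed
qed


lemma has_remove1:
  assumes "carcs C = insert (pt x a, pt x (a + l x)) K" "has C v i" "\<not> (v = x \<and> pt x i = pt x a)"
  shows "(pt v i, pt v (i + l v)) \<in> K \<union> K\<inverse>"
  using assms step_eq[of v i x a] step_ne[of v i x a] unfolding has_def links_def by blast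

text \<open>The second arc is allowed in either direction, so that cuts with equal and with opposite
  directions are both covered.\<close>

lemma has_remove2:
  assumes "carcs C = insert (pt x a, pt x (a + l x)) (insert e K)"
    and "e = (pt x b, pt x (b + l x)) \<or> e = (pt x (b + l x), pt x b)"
    and "has C v i" "\<not> (v = x \<and> (pt x i = pt x a \<or> pt x i = pt x b))"
  shows "(pt v i, pt v (i + l v)) \<in> K \<union> K\<inverse>"
  using assms step_eq[of v i x a] step_ne[of v i x a] step_eq[of v i x b] step_ne[of v i x b]
  unfolding has_def links_def by blast

lemma hasI: "(pt v i, pt v (i + l v)) \<in> K \<union> K\<inverse> \<Longrightarrow> K \<subseteq> links C \<Longrightarrow> has C v i"
  unfolding has_def links_def by blast

lemma links_append: "v \<noteq> [] \<Longrightarrow> w \<noteq> [] \<Longrightarrow> arcs v \<union> arcs w \<subseteq> links (v @ w)"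
  by (auto simp: links_def carcs_def)

lemma links_append4:
  "u \<noteq> [] \<Longrightarrow> v \<noteq> [] \<Longrightarrow> w \<noteq> [] \<Longrightarrow> z \<noteq> [] \<Longrightarrow>
    arcs u \<union> arcs v \<union> arcs w \<union> arcs z \<subseteq> links (u @ v @ w @ z)"
  by (auto simp: links_def carcs_def)

lemma links_mono_rev: "arcs (rev w) \<subseteq> links C \<Longrightarrow> arcs w \<subseteq> links C"
  by (auto simp: links_def)

lemma arcs_rev_G: "arcs w \<subseteq> G \<Longrightarrow> arcs (rev w) \<subseteq> G"
  using sym_G by (auto simp: sym_def)

lemma cyc2:
  assumes "v \<noteq> []" "w \<noteq> []" "distinct v" "distinct w" "set v \<inter> set w = {}"
    "arcs v \<subseteq> G" "arcs w \<subseteq> G" "(last v, hd w) \<in> G" "(last w, hd v) \<in> G"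
  shows "cyc G (v @ w)"
  using assms by (auto simp: cyc_def carcs_def)

lemma cyc4:
  assumes "u \<noteq> []" "v \<noteq> []" "w \<noteq> []" "z \<noteq> []" "distinct (u @ v @ w @ z)"
    "arcs u \<subseteq> G" "arcs v \<subseteq> G" "arcs w \<subseteq> G" "arcs z \<subseteq> G"
    "(last u, hd v) \<in> G" "(last v, hd w) \<in> G" "(last w, hd z) \<in> G" "(last z, hd u) \<in> G"
  shows "cyc G (u @ v @ w @ z)"
  using assms by (auto simp: cyc_def carcs_def)

text \<open>Here \<open>P\<close> joins \<open>a + t\<close> to \<open>a + d\<close>, which are also
  the ends of \<open>Y\<close>, and \<open>Q\<close> joins the ends of \<open>Z\<close>; hence the
  rungs close \<open>P\<close> with \<open>Y\<close> and \<open>Q\<close> with \<open>Z\<close>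
  separately. The listed memberships tell on which cycle the edges next to the cuts lie, which is
  what a later repair needs.\<close>

lemma attach_same:
  fixes x y a
  defines "t \<equiv> l x" and "d \<equiv> off (l x) (l y)" and "e \<equiv> off (l y) (l x)"
  assumes C: "cyc G C" "set C \<inter> layer y = {}" and nb: "nb x y"
    and arcs: "(pt x a, pt x (a + t)) \<in> carcs C" "(pt x (a + d), pt x (a + d + t)) \<in> carcs C"
  obtains D D' where "cyc G D" "cyc G D'" "set D \<inter> set D' = {}" "set D \<union> set D' = set C \<union> layer y"
    "pt x (a + t) \<in> set D" "pt x (a + d) \<in> set D" "pt x a \<in> set D'"
    "pt y (a + d) \<in> set D" "pt y (a + t) \<in> set D" "pt y a \<in> set D'"
    "\<And>v i. has C v i \<Longrightarrow> \<not> (v = x \<and> (pt x i = pt x a \<or> pt x i = pt x (a + d))) \<Longrightarrow>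
       has D v i \<or> has D' v i"
    "\<And>i. pt y i \<noteq> pt y a \<Longrightarrow> pt y i \<noteq> pt y (a + e) \<Longrightarrow> has D y i \<or> has D' y i"
proof -
  obtain P Q where PQ: "P \<noteq> []" "Q \<noteq> []" "distinct P" "distinct Q" "set P \<inter> set Q = {}"
    "set C = set P \<union> set Q" "hd P = pt x (a + t)" "last P = pt x (a + d)"
    "hd Q = pt x (a + d + t)" "last Q = pt x a" "arcs P \<subseteq> G" "arcs Q \<subseteq> G"
    "carcs C = insert (pt x a, pt x (a + t)) (insert (pt x (a + d), pt x (a + d + t)) (arcs P \<union> arcs Q))"
    by (rule cyc_cut[OF C(1) arcs]) (simp add: d_def)
  obtain Y Z where YZ: "Y \<noteq> []" "Z \<noteq> []" "distinct Y" "distinct Z" "set Y \<inter> set Z = {}"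
    "set Y \<union> set Z = layer y" "arcs Y \<subseteq> G" "arcs Z \<subseteq> G"
    "hd Y = pt y (a + d)" "last Y = pt y (a + t)" "hd Z = pt y (a + d + t)" "last Z = pt y a"
    "\<And>i. pt y i \<noteq> pt y a \<Longrightarrow> pt y i \<noteq> pt y (a + e) \<Longrightarrow>
       (pt y i, pt y (i + l y)) \<in> (arcs Y \<union> arcs Z) \<union> (arcs Y \<union> arcs Z)\<inverse>"
    unfolding t_def d_def e_def by (rule split_fibre[of y a x]) blast
  note rung = G_rung[OF nb]
  have dj: "set P \<inter> set Y = {}" "set P \<inter> set Z = {}" "set Q \<inter> set Y = {}" "set Q \<inter> set Z = {}"
    using C(2) PQ(6) YZ(6) by blast+
  have lD: "arcs P \<union> arcs Y \<subseteq> links (P @ Y)" by (rule links_append[OF PQ(1) YZ(1)])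
  have lD': "arcs Q \<union> arcs Z \<subseteq> links (Q @ rev Z)"
    using links_append[of Q "rev Z"] PQ(2) YZ(2) links_mono_rev[of Z "Q @ rev Z"] by simp
  show thesis
  proof (rule that[of "P @ Y" "Q @ rev Z"])
    show "cyc G (P @ Y)" using PQ YZ dj rung by (intro cyc2) auto
    show "cyc G (Q @ rev Z)"
      using PQ YZ dj rung by (intro cyc2 arcs_rev_G) (auto simp: hd_rev last_rev)
    show "set (P @ Y) \<inter> set (Q @ rev Z) = {}" using dj PQ(5) YZ(5) by auto
    show "set (P @ Y) \<union> set (Q @ rev Z) = set C \<union> layer y" using PQ(6) YZ(6) by auto
    show "pt x (a + t) \<in> set (P @ Y)" "pt x (a + d) \<in> set (P @ Y)" "pt x a \<in> set (Q @ rev Z)"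
      "pt y (a + d) \<in> set (P @ Y)" "pt y (a + t) \<in> set (P @ Y)" "pt y a \<in> set (Q @ rev Z)"
      using PQ(1,2,7-10) YZ(1,2,9-12) by (metis UnCI hd_in_set last_in_set set_append set_rev)+
  next
    fix v i assume "has C v i" "\<not> (v = x \<and> (pt x i = pt x a \<or> pt x i = pt x (a + d)))"
    then have "(pt v i, pt v (i + l v)) \<in> (arcs P \<union> arcs Q) \<union> (arcs P \<union> arcs Q)\<inverse>"
      using PQ(13) unfolding t_def by (intro has_remove2) auto
    then show "has (P @ Y) v i \<or> has (Q @ rev Z) v i"
      using lD lD' unfolding has_def links_def by blast
  next
    fix i assume "pt y i \<noteq> pt y a" "pt y i \<noteq> pt y (a + e)"
    from YZ(13)[OF this] show "has (P @ Y) y i \<or> has (Q @ rev Z) y i"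
      using lD lD' unfolding has_def links_def by blast
  qed
qed

lemma has_orient:
  assumes "cyc G C" "has C v i"
  obtains C' where "cyc G C'" "set C' = set C" "links C' = links C" "(pt v i, pt v (i + l v)) \<in> carcs C'"
  using cyc_orient[OF sym_G assms(1) assms(2)[unfolded has_def]] .

text \<open>Two separate cycles can be oriented independently of each other, so only the presence of
  the two edges matters. The two pieces of the layer \<open>w\<close> become bridges between the
  opened cycles.\<close>

lemma attach_join:
  fixes v w c
  defines "d \<equiv> off (l v) (l w)" and "e \<equiv> off (l w) (l v)"
  assumes D: "cyc G D" "cyc G D'" "set D \<inter> set D' = {}" "(set D \<union> set D') \<inter> layer w = {}"
    and nb: "nb v w" and has: "has D v c" "has D' v (c + d)"
  obtains C where "cyc G C" "set C = set D \<union> set D' \<union> layer w"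
    "\<And>u i. has D u i \<or> has D' u i \<Longrightarrow> \<not> (u = v \<and> (pt v i = pt v c \<or> pt v i = pt v (c + d))) \<Longrightarrow>
       has C u i"
    "\<And>i. pt w i \<noteq> pt w c \<Longrightarrow> pt w i \<noteq> pt w (c + e) \<Longrightarrow> has C w i"
proof -
  obtain E where E: "cyc G E" "set E = set D" "links E = links D" "(pt v c, pt v (c + l v)) \<in> carcs E"
    using has_orient[OF D(1) has(1)] .
  obtain E' where E': "cyc G E'" "set E' = set D'" "links E' = links D'"
    "(pt v (c + d), pt v (c + d + l v)) \<in> carcs E'"
    using has_orient[OF D(2) has(2)] .
  obtain P where P: "P \<noteq> []" "distinct P" "set P = set E" "hd P = pt v (c + l v)" "last P = pt v c"
     "arcs P \<subseteq> G" "carcs E = insert (pt v c, pt v (c + l v)) (arcs P)"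
    using cyc_open[OF E(1,4)] .
  obtain Q where Q: "Q \<noteq> []" "distinct Q" "set Q = set E'" "hd Q = pt v (c + d + l v)"
     "last Q = pt v (c + d)" "arcs Q \<subseteq> G"
     "carcs E' = insert (pt v (c + d), pt v (c + d + l v)) (arcs Q)"
    using cyc_open[OF E'(1,4)] .
  obtain Y Z where YZ: "Y \<noteq> []" "Z \<noteq> []" "distinct Y" "distinct Z" "set Y \<inter> set Z = {}"
    "set Y \<union> set Z = layer w" "arcs Y \<subseteq> G" "arcs Z \<subseteq> G"
    "hd Y = pt w (c + d)" "last Y = pt w (c + l v)" "hd Z = pt w (c + d + l v)" "last Z = pt w c"
    "\<And>i. pt w i \<noteq> pt w c \<Longrightarrow> pt w i \<noteq> pt w (c + e) \<Longrightarrow>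
       (pt w i, pt w (i + l w)) \<in> (arcs Y \<union> arcs Z) \<union> (arcs Y \<union> arcs Z)\<inverse>"
    unfolding d_def e_def by (rule split_fibre[of w c v]) blast
  note rung = G_rung[OF nb]
  let ?C = "P @ rev Z @ Q @ Y"
  have sets: "set P = set D" "set Q = set D'" using P(3) Q(3) E(2) E'(2) by simp_all
  have l: "arcs P \<union> arcs Z \<union> arcs Q \<union> arcs Y \<subseteq> links ?C"
    using links_append4[of P "rev Z" Q Y] P(1) Q(1) YZ(1,2) links_mono_rev[of Z ?C] by simp
  have dist: "distinct ?C" using sets D(3,4) YZ(3-6) P(2) Q(2) by auto
  show thesis
  proof (rule that[of ?C])
    show "cyc G ?C"
      by (rule cyc4) (use P Q YZ rung dist arcs_rev_G in \<open>simp_all add: hd_rev last_rev\<close>)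
    show "set ?C = set D \<union> set D' \<union> layer w" using sets YZ(6) by auto
  next
    fix u i assume *: "has D u i \<or> has D' u i" "\<not> (u = v \<and> (pt v i = pt v c \<or> pt v i = pt v (c + d)))"
    have "has E u i \<or> has E' u i" using *(1) E(3) E'(3) by (simp add: has_def)
    then have "(pt u i, pt u (i + l u)) \<in> (arcs P \<union> arcs Q) \<union> (arcs P \<union> arcs Q)\<inverse>"
      using has_remove1[OF P(7), of u i] has_remove1[OF Q(7), of u i] *(2) by blast
    then show "has ?C u i" using l by (intro hasI[of u i "arcs P \<union> arcs Q"]) auto
  next
    fix i assume "pt w i \<noteq> pt w c" "pt w i \<noteq> pt w (c + e)"
    from YZ(13)[OF this] show "has ?C w i"
      using l by (intro hasI[of w i "arcs Y \<union> arcs Z"]) auto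
  qed
qed

text \<open>Now \<open>P\<close> joins \<open>a + t\<close> to \<open>a + d + t\<close> and
  \<open>Q\<close> joins \<open>a + d\<close> to \<open>a\<close>, so that each of them has one end
  next to \<open>Y\<close> and one next to \<open>Z\<close>: the four paths alternate in a single
  cycle. The three rungs in the conclusion determine the direction of the edges of \<open>x\<close>
  next to the cuts.\<close>

lemma attach_opp:
  fixes x y a
  defines "t \<equiv> l x" and "d \<equiv> off (l x) (l y)" and "e \<equiv> off (l y) (l x)"
  assumes C: "cyc G C" "set C \<inter> layer y = {}" and nb: "nb x y"
    and arcs: "(pt x a, pt x (a + t)) \<in> carcs C" "(pt x (a + d + t), pt x (a + d)) \<in> carcs C"
  obtains D where "cyc G D" "set D = set C \<union> layer y"
    "\<And>v i. has C v i \<Longrightarrow> \<not> (v = x \<and> (pt x i = pt x a \<or> pt x i = pt x (a + d))) \<Longrightarrow> has D v i"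
    "\<And>i. pt y i \<noteq> pt y a \<Longrightarrow> pt y i \<noteq> pt y (a + e) \<Longrightarrow> has D y i"
    "(pt x a, pt y a) \<in> carcs D" "(pt x (a + t), pt y (a + t)) \<in> carcs D"
    "(pt y (a + d), pt x (a + d)) \<in> carcs D"
proof -
  \<comment> \<open>If the two tails agreed, so would the heads, and \<open>d\<close> would be
    congruent both to \<open>t\<close> and to \<open>- t\<close>.\<close>
  have ne: "pt x (a + d + t) \<noteq> pt x a"
    using arcs carcs_succ_unique[of C] C(1) step_ne[of x "a + d" x a] unfolding cyc_def
    by (metis add.commute carcs_pred_unique d_def pt_add_cancel pt_off_ne t_def)
  obtain P Q where PQ: "P \<noteq> []" "Q \<noteq> []" "distinct P" "distinct Q" "set P \<inter> set Q = {}"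
    "set C = set P \<union> set Q" "hd P = pt x (a + t)" "last P = pt x (a + d + t)"
    "hd Q = pt x (a + d)" "last Q = pt x a" "arcs P \<subseteq> G" "arcs Q \<subseteq> G"
    "carcs C = insert (pt x a, pt x (a + t)) (insert (pt x (a + d + t), pt x (a + d)) (arcs P \<union> arcs Q))"
    by (rule cyc_cut[OF C(1) arcs ne])
  obtain Y Z where YZ: "Y \<noteq> []" "Z \<noteq> []" "distinct Y" "distinct Z" "set Y \<inter> set Z = {}"
    "set Y \<union> set Z = layer y" "arcs Y \<subseteq> G" "arcs Z \<subseteq> G"
    "hd Y = pt y (a + d)" "last Y = pt y (a + t)" "hd Z = pt y (a + d + t)" "last Z = pt y a"
    "\<And>i. pt y i \<noteq> pt y a \<Longrightarrow> pt y i \<noteq> pt y (a + e) \<Longrightarrow>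
       (pt y i, pt y (i + l y)) \<in> (arcs Y \<union> arcs Z) \<union> (arcs Y \<union> arcs Z)\<inverse>"
    unfolding t_def d_def e_def by (rule split_fibre[of y a x]) blast
  note rung = G_rung[OF nb]
  let ?C = "Q @ rev Z @ rev P @ rev Y"
  have l: "arcs Q \<union> arcs Z \<union> arcs P \<union> arcs Y \<subseteq> links ?C"
    using links_append4[of Q "rev Z" "rev P" "rev Y"] PQ(1,2) YZ(1,2) links_mono_rev[of _ ?C] by simp
  have dist: "distinct ?C" using PQ(3-6) YZ(3-6) C(2) by auto
  show thesis
  proof (rule that[of ?C])
    show "cyc G ?C"
      by (rule cyc4) (use PQ YZ rung dist arcs_rev_G in \<open>simp_all add: hd_rev last_rev\<close>)
    show "set ?C = set C \<union> layer y" using PQ(6) YZ(6) by auto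
    show "(pt x a, pt y a) \<in> carcs ?C" "(pt x (a + t), pt y (a + t)) \<in> carcs ?C"
      "(pt y (a + d), pt x (a + d)) \<in> carcs ?C"
      using PQ(1,2,7-10) YZ(1,2,9-12) by (simp_all add: carcs_def hd_rev last_rev)
  next
    fix v i assume "has C v i" "\<not> (v = x \<and> (pt x i = pt x a \<or> pt x i = pt x (a + d)))"
    then have "(pt v i, pt v (i + l v)) \<in> (arcs P \<union> arcs Q) \<union> (arcs P \<union> arcs Q)\<inverse>"
      using PQ(13) unfolding t_def by (intro has_remove2) auto
    then show "has ?C v i" using l by (intro hasI[of v i "arcs P \<union> arcs Q"]) auto
  next
    fix i assume "pt y i \<noteq> pt y a" "pt y i \<noteq> pt y (a + e)"
    from YZ(13)[OF this] show "has ?C y i"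
      using l by (intro hasI[of y i "arcs Y \<union> arcs Z"]) auto
  qed
qed

end

text \<open>Successors in a list without repetitions are unique, so a chain of known arcs that
  starts at the head is an initial segment.\<close>

lemma arcs_prefix:
  assumes "distinct P" "P \<noteq> []" "hd P = f 0" "\<And>j. j < k \<Longrightarrow> (f j, f (Suc j)) \<in> arcs P"
  obtains W where "P = map f [0..<Suc k] @ W"
proof -
  have "\<exists>W. P = map f [0..<Suc k] @ W"
    using assms(4)
  proof (induction k)
    case 0
    show ?case using assms(2,3) by (cases P) auto
  next
    case (Suc k)
    then obtain W where W: "P = map f [0..<Suc k] @ W" by auto
    have arc: "(f k, f (Suc k)) \<in> arcs P" using Suc.prems by simp
    have ne: "W \<noteq> []"
      using arc arcs_last_notin[OF assms(1), of "f (Suc k)"] W by auto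
    then have "(f k, hd W) \<in> arcs P"
      unfolding W using arcs_append[of "map f [0..<Suc k]" W] by (simp del: arcs_append)
    then have "hd W = f (Suc k)"
      using arc by (intro carcs_succ_unique[OF assms(1,2), of "f k"]) (simp_all add: carcs_def)
    with ne W have "P = map f [0..<Suc (Suc k)] @ tl W" by (cases W) auto
    then show ?case by blast
  qed
  then show thesis using that by blast
qed

text \<open>
  A sign or colour \<open>g\<close> on the edges of one layer that is constant along the layer off two missing
  edges but differs across one of them. Comparing with the edges shifted by \<open>r\<close>, where nothing is
  missing, yields two edges at the distance \<open>off t r\<close> with different values.
\<close>

lemma shifted_gap:
  fixes g :: "int \<Rightarrow> bool" and a t d r :: int
  assumes pos: "0 < t" "0 < d" "d \<noteq> t" "0 < r"
    and const: "\<And>i. a - t - r \<le> i \<Longrightarrow> i \<le> a + r \<Longrightarrow> i \<notin> {a, a + d} \<Longrightarrow> i + t \<notin> {a, a + d} \<Longrightarrow>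
      g i = g (i + t)"
    and gap: "g (a - t) \<noteq> g (a + t)"
    and half: "t = 2 * d \<Longrightarrow> g (a - t + d) \<noteq> g (a - t)"
  obtains c where "a - t - r \<le> c" "c \<le> a + t" "c + off t r \<le> a + t + r"
    "c \<notin> {a, a + d}" "c + off t r \<notin> {a, a + d}" "g c \<noteq> g (c + off t r)"
proof -
  \<comment> \<open>Shifting the edges at \<open>a - t\<close>, \<open>a\<close>,
    \<open>a + t\<close> down by \<open>r\<close> meets a missing edge only if \<open>r = t\<close>
    or \<open>r = t - d\<close>. If \<open>r = t\<close>, the offset \<open>2 * t\<close> spans the
    gap itself. If \<open>r = t - d\<close>, shifting up by \<open>r\<close> works unless
    \<open>t = 2 * d\<close>; in that case \<open>r = d\<close>, both shifts meet
    \<open>a + d\<close>, and \<open>half\<close> provides the pair directly.\<close>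
  have "r = t \<or> r \<noteq> t \<and> r \<noteq> t - d \<or> r = t - d \<and> t \<noteq> 2 * d \<or> r = d \<and> t = 2 * d" by arith
  then consider "r = t" | "r \<noteq> t" "r \<noteq> t - d" | "r = t - d" "t \<noteq> 2 * d" | "r = d" "t = 2 * d"
    by blast
  then show thesis
  proof cases
    case 1
    then have e: "a - t + off t r = a + t" by (simp add: off_def)
    show thesis using pos gap by (intro that[of "a - t"]) (auto simp: e)
  next
    case 2
    have "g (a - t - r) = g (a - r)" "g (a - r) = g (a + t - r)"
      using const[of "a - t - r"] const[of "a - r"] pos 2 by (auto simp: algebra_simps)
    then have "g (a - t - r) \<noteq> g (a - t) \<or> g (a + t - r) \<noteq> g (a + t)" using gap by auto
    then show thesis
    proof
      assume "g (a - t - r) \<noteq> g (a - t)"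
      then show thesis using pos 2 by (intro that[of "a - t - r"]) (auto simp: off_def)
    next
      assume "g (a + t - r) \<noteq> g (a + t)"
      then show thesis using pos 2 by (intro that[of "a + t - r"]) (auto simp: off_def)
    qed
  next
    case 3
    have "g (a - t + r) = g (a + r)" "g (a + r) = g (a + t + r)"
      using const[of "a - t + r"] const[of "a + r"] pos 3 by (auto simp: algebra_simps)
    then have "g (a - t + r) \<noteq> g (a - t) \<or> g (a + t + r) \<noteq> g (a + t)" using gap by auto
    then show thesis
    proof
      assume "g (a - t + r) \<noteq> g (a - t)"
      then show thesis using pos 3 by (intro that[of "a - t"]) (auto simp: off_def)
    next
      assume "g (a + t + r) \<noteq> g (a + t)"
      then show thesis using pos 3 by (intro that[of "a + t"]) (auto simp: off_def)
    qed
  next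
    case 4
    then show thesis using pos half by (intro that[of "a - t"]) (auto simp: off_def)
  qed
qed

context voltage_lift
begin

lemma pt_near: "\<bar>i - j\<bar> < int p \<Longrightarrow> pt v i = pt v j \<longleftrightarrow> i = j"
  using dvd_imp_le_int[of "i - j" "int p"] by (auto simp: pt_eq_iff)

lemma edge_remove2:
  assumes "(pt v i, pt v (i + l v)) \<in> K \<union> K\<inverse>"
    and "K = insert (pt x a, pt x (a + l x)) (insert (pt x (b + l x), pt x b) K')"
    and "\<not> (v = x \<and> (pt x i = pt x a \<or> pt x i = pt x b))"
  shows "(pt v i, pt v (i + l v)) \<in> K' \<union> K'\<inverse>"
  using assms step_eq[of v i x a] step_ne[of v i x a] step_eq[of v i x b] step_ne[of v i x b]
  by blast

text \<open>
  After \<open>attach_opp\<close> the cycle runs through the whole layer \<open>y\<close> in one direction. Attaching \<open>y\<close>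
  at a second pair of edges, nested inside the first one, reverses a part of it.
\<close>

lemma attach_opp_twice:
  fixes x y a and k :: nat
  defines "t \<equiv> l x" and "s \<equiv> l y" and "b \<equiv> a + int k * l x"
  assumes C: "cyc G C" "set C \<inter> layer y = {}" and nb: "nb x y" and st: "s \<noteq> t"
    and k: "k \<ge> 2" and small: "(int k + 1) * t + s < int p"
    and up: "\<And>j. j \<le> k \<Longrightarrow> (pt x (a + int j * t), pt x (a + int j * t + t)) \<in> carcs C"
    and down: "\<And>j. j \<le> k \<Longrightarrow> (pt x (a + s + int j * t + t), pt x (a + s + int j * t)) \<in> carcs C"
  obtains D where "cyc G D" "set D = set C \<union> layer y"
    "\<And>v i. has C v i \<Longrightarrow> \<not> (v = x \<and> pt x i \<in> {pt x a, pt x (a + s), pt x b, pt x (b + s)}) \<Longrightarrow> has D v i"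
    "\<And>i. pt y i \<notin> {pt y a, pt y (a + t), pt y b, pt y (b + t)} \<Longrightarrow> has D y i"
    "(pt y b, pt x b) \<in> carcs D" "(pt y (b + s), pt x (b + s)) \<in> carcs D"
proof -
  have pos: "0 < t" "0 < s" using l_pos by (simp_all add: t_def s_def)
  have off: "off (l x) (l y) = s" "off (l y) (l x) = t"
    using st by (auto simp: off_def s_def t_def)
  have kt: "int k * t \<ge> 2 * t" using k pos by simp
  have near: "pt v i = pt v j \<longleftrightarrow> i = j" if "\<bar>i - j\<bar> \<le> int k * t + t + s" for v i j
    using small that by (intro pt_near) (auto simp: algebra_simps)
  have near_ne: "pt v i \<noteq> pt v j" if "i \<noteq> j" "\<bar>i - j\<bar> \<le> int k * t + t + s" for v i j
    using near that by blast
  have ne: "pt x (a + s + t) \<noteq> pt x a" using pos kt by (subst near) auto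
  have arc0: "(pt x a, pt x (a + t)) \<in> carcs C" "(pt x (a + s + t), pt x (a + s)) \<in> carcs C"
    using up[of 0] down[of 0] by simp_all
  obtain P Q where PQ: "P \<noteq> []" "Q \<noteq> []" "distinct P" "distinct Q" "set P \<inter> set Q = {}"
    "set C = set P \<union> set Q" "hd P = pt x (a + t)" "last P = pt x (a + s + t)"
    "hd Q = pt x (a + s)" "last Q = pt x a" "arcs P \<subseteq> G" "arcs Q \<subseteq> G"
    "carcs C = insert (pt x a, pt x (a + t)) (insert (pt x (a + s + t), pt x (a + s)) (arcs P \<union> arcs Q))"
    by (rule cyc_cut[OF C(1) arc0 ne])
  have Suc_t: "0 < int (Suc j) * t" "int (Suc j) * t \<le> int k * t" if "j < k" for j
    using that pos by (auto intro!: mult_right_mono mult_pos_pos simp del: of_nat_Suc)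
  \<comment> \<open>The ascending vertices from \<open>a + t\<close> to \<open>b + t\<close>.
    \<open>P\<close> starts at the lowest of them and cannot deviate, so that it passes the edge at
    \<open>b\<close> upwards.\<close>
  define f where "f j = pt x (a + int (Suc j) * t)" for j
  have f_arc: "(f j, f (Suc j)) \<in> arcs P \<union> arcs Q" if "j < k" for j
  proof -
    have "(f j, f (Suc j)) \<in> carcs C"
      using up[of "Suc j"] that by (simp add: f_def algebra_simps)
    moreover have "f j \<noteq> pt x a"
      unfolding f_def by (rule near_ne) (use Suc_t[OF that] pos in linarith)+
    moreover have "(f j, f (Suc j)) \<noteq> (pt x (a + s + t), pt x (a + s))"
      using step_ne[of x "a + int (Suc j) * t" x "a + s"] by (auto simp: f_def t_def algebra_simps)
    ultimately show ?thesis using PQ(13) by auto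
  qed
  have f_P: "f j \<in> set P" if "j \<le> k" for j
    using that
  proof (induction j)
    case 0
    show ?case using PQ(1,7) hd_in_set by (fastforce simp: f_def)
  next
    case (Suc j)
    then have "f j \<notin> set Q" using PQ(5) by auto
    then have "(f j, f (Suc j)) \<in> arcs P" using Suc.prems f_arc[of j] arcs_avoid(1)[of "f j" Q] by auto
    then show ?case using arcs_set by metis
  qed
  have f_arc_P: "(f j, f (Suc j)) \<in> arcs P" if "j < k" for j
  proof -
    have "f j \<notin> set Q" using f_P[of j] that PQ(5) by auto
    then show ?thesis using f_arc[OF that] arcs_avoid(1)[of "f j" Q] by auto
  qed
  obtain W where W: "P = map f [0..<Suc k] @ W"
    using arcs_prefix[OF PQ(3,1), of f k] PQ(7) f_arc_P by (auto simp: f_def)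
  define B where "B = map f [0..<k]"
  have B: "B \<noteq> []" "hd B = pt x (a + t)" "last B = pt x b"
    using k by (auto simp: B_def hd_map last_map f_def b_def t_def hd_upt last_upt)
  define W' where "W' = f k # W"
  have PBW: "P = B @ W'" using W by (simp add: B_def W'_def)
  have fk: "f k = pt x (b + t)" by (simp add: f_def b_def t_def algebra_simps)
  \<comment> \<open>The descending counterpart, traced backwards from the end
    \<open>a + s + t\<close> of \<open>P\<close>. It shows that \<open>P\<close> also contains the
    edge at \<open>b + s\<close>, traversed downwards.\<close>
  define h where "h j = pt x (a + s + int (Suc j) * t)" for j
  have h_arc: "(h (Suc j), h j) \<in> arcs P \<union> arcs Q" if "j < k" for j
  proof -
    have "(h (Suc j), h j) \<in> carcs C"
      using down[of "Suc j"] that by (simp add: h_def algebra_simps)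
    moreover have "h j \<noteq> pt x (a + s)"
      unfolding h_def by (rule near_ne) (use Suc_t[OF that] pos in linarith)+
    moreover have "(h (Suc j), h j) \<noteq> (pt x a, pt x (a + t))"
      using step_ne[of x "a + s + int (Suc j) * t" x "a"] by (auto simp: h_def t_def algebra_simps)
    ultimately show ?thesis using PQ(13) by auto
  qed
  have h_P: "h j \<in> set P" if "j \<le> k" for j
    using that
  proof (induction j)
    case 0
    show ?case using PQ(1,8) last_in_set by (fastforce simp: h_def)
  next
    case (Suc j)
    then have "h j \<notin> set Q" using PQ(5) by auto
    then have "(h (Suc j), h j) \<in> arcs P" using Suc.prems h_arc[of j] arcs_avoid(2)[of "h j" Q] by auto
    then show ?case using arcs_set by metis
  qed
  have "h (k - 1) \<notin> set Q" using h_P[of "k - 1"] PQ(5) by auto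
  then have "(h (Suc (k - 1)), h (k - 1)) \<in> arcs P"
    using h_arc[of "k - 1"] k arcs_avoid(2)[of "h (k - 1)" Q] by auto
  then have b'_P: "(pt x (b + s + t), pt x (b + s)) \<in> arcs P"
    using k by (simp add: h_def b_def t_def algebra_simps)
  have "pt x (b + s) \<notin> set B"
  proof
    assume "pt x (b + s) \<in> set B"
    then obtain j where j: "j < k" "pt x (b + s) = f j" by (auto simp: B_def)
    have *: "int (Suc j) * t \<le> int k * t" using j pos by (intro mult_right_mono) auto
    have "pt x (b + s) \<noteq> f j"
      unfolding f_def b_def t_def[symmetric] by (rule near_ne) (use * Suc_t[of j] j(1) pos in linarith)+
    with j show False by simp
  qed
  moreover have "pt x (b + s) \<noteq> f k"
    unfolding fk by (rule near_ne) (use st pos kt in linarith)+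
  moreover have "arcs P = insert (last B, f k) (arcs B \<union> arcs W')"
    unfolding PBW using arcs_append[of B W'] B(1) by (simp add: W'_def del: arcs_append)
  ultimately have "(pt x (b + s + t), pt x (b + s)) \<in> arcs W'"
    using b'_P arcs_avoid(2)[of "pt x (b + s)" B] by blast
  then obtain X B' where XB: "W' = X @ B'" "X \<noteq> []" "B' \<noteq> []" "last X = pt x (b + s + t)"
    "hd B' = pt x (b + s)"
    by (rule arcs_split)
  have hdX: "hd X = pt x (b + t)" using XB(1,2) fk by (cases X) (auto simp: W'_def)
  have lastB': "last B' = pt x (a + s + t)" using PQ(8) XB(1,3) PBW by simp
  have P: "P = B @ X @ B'" using PBW XB(1) by simp
  have arcs_P: "arcs P = insert (pt x b, pt x (b + t))
      (insert (pt x (b + s + t), pt x (b + s)) (arcs B \<union> arcs X \<union> arcs B'))"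
    unfolding P using B XB hdX by auto
  obtain Y Z where YZ: "Y \<noteq> []" "Z \<noteq> []" "distinct Y" "distinct Z" "set Y \<inter> set Z = {}"
    "set Y \<union> set Z = layer y" "arcs Y \<subseteq> G" "arcs Z \<subseteq> G"
    "hd Y = pt y (a + s)" "last Y = pt y (a + t)" "hd Z = pt y (a + s + t)" "last Z = pt y a"
    "\<And>i. pt y i \<noteq> pt y a \<Longrightarrow> pt y i \<noteq> pt y (a + t) \<Longrightarrow> (pt y i, pt y (i + s)) \<in> arcs Y \<union> arcs Z"
    unfolding s_def t_def
    by (rule split_fibre[of y a x, unfolded off s_def t_def]) (use st in \<open>unfold s_def t_def, metis\<close>)
  note rung = G_rung[OF nb]
  \<comment> \<open>\<open>U @ rev X\<close> is, up to rotation, the cycle that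
    \<open>attach_opp\<close> produces, with \<open>X\<close> the part of \<open>P\<close> between
    the edges at \<open>b\<close> and \<open>b + s\<close>. Thus \<open>U\<close> contains both
    pieces of the layer \<open>y\<close>, reversed, and all edges of \<open>y\<close> that are left
    are traversed downwards.\<close>
  define U where "U = rev B @ rev Y @ Q @ rev Z @ rev B'"
  have arcs_U: "arcs U \<subseteq> G"
    unfolding U_def using B XB lastB' PQ YZ rung arcs_rev_G[of B] arcs_rev_G[of B'] arcs_rev_G[of Y]
      arcs_rev_G[of Z] arcs_P by (simp add: hd_rev last_rev)
  have X_G: "arcs X \<subseteq> G" using PQ(11) arcs_P by simp
  have U: "U \<noteq> []" "hd U = pt x b" "last U = pt x (b + s)"
    unfolding U_def using B XB by (simp_all add: hd_rev last_rev)
  have dist: "distinct U" "distinct X" "set U \<inter> set X = {}"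
    using PQ(3-6) YZ(3-6) C(2) unfolding U_def P by auto
  have set_U: "set U \<union> set X = set C \<union> layer y"
    using PQ(6) YZ(6) unfolding U_def P by auto
  have U_sup: "(arcs B)\<inverse> \<union> (arcs Y)\<inverse> \<union> arcs Q \<union> (arcs Z)\<inverse> \<union> (arcs B')\<inverse> \<subseteq> arcs U"
    unfolding U_def using B XB PQ(2) YZ(1,2) by auto
  have y_arc: "(pt y (b + s), pt y b) \<in> arcs U" "(pt y (b + s + t), pt y (b + t)) \<in> arcs U"
  proof -
    have "pt y b \<noteq> pt y a" "pt y b \<noteq> pt y (a + t)" "pt y (b + t) \<noteq> pt y a" "pt y (b + t) \<noteq> pt y (a + t)"
      unfolding b_def t_def[symmetric] by (rule near_ne; use pos kt in linarith)+
    then have "(pt y b, pt y (b + s)) \<in> arcs Y \<union> arcs Z" "(pt y (b + t), pt y (b + t + s)) \<in> arcs Y \<union> arcs Z"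
      using YZ(13) by blast+
    moreover have "(arcs Y)\<inverse> \<subseteq> arcs U" "(arcs Z)\<inverse> \<subseteq> arcs U" using U_sup by simp_all
    ultimately have "(pt y (b + s), pt y b) \<in> arcs U" "(pt y (b + t + s), pt y (b + t)) \<in> arcs U"
      by auto
    then show "(pt y (b + s), pt y b) \<in> arcs U" "(pt y (b + s + t), pt y (b + t)) \<in> arcs U"
      by (simp_all add: add.assoc add.commute[of s t])
  qed
  obtain R T where RT: "U = R @ T" "R \<noteq> []" "T \<noteq> []" "last R = pt y (b + s)" "hd T = pt y b"
    using arcs_split[OF y_arc(1)] .
  have "pt y (b + s + t) \<noteq> pt y (b + s)" by (simp add: t_def)
  then have two: "(pt y (b + s + t), pt y (b + t)) \<in> arcs R \<or> (pt y (b + s + t), pt y (b + t)) \<in> arcs T"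
    using y_arc(2) RT by auto
  \<comment> \<open>It is not known which of the two edges of \<open>y\<close> comes earlier on
    \<open>U\<close>. Both orders admit a reconnection into one cycle, with \<open>X\<close>
    inserted forwards or backwards, and in both the cycle leaves \<open>y\<close> for
    \<open>x\<close> at \<open>b\<close> and at \<open>b + s\<close>. This forces different
    directions on the two sides of the gap.\<close>
  have "\<exists>D. cyc G D \<and> set D = set U \<union> set X \<and> arcs X \<subseteq> links D \<and>
      arcs U - {(pt y (b + s), pt y b), (pt y (b + s + t), pt y (b + t))} \<subseteq> links D \<and>
      (pt y b, pt x b) \<in> carcs D \<and> (pt y (b + s), pt x (b + s)) \<in> carcs D"
    using two
  proof
    assume "(pt y (b + s + t), pt y (b + t)) \<in> arcs T"
    then obtain S V where SV: "T = S @ V" "S \<noteq> []" "V \<noteq> []" "last S = pt y (b + s + t)" "hd V = pt y (b + t)"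
      by (rule arcs_split)
    have ends: "hd S = pt y b" "last V = pt x (b + s)" "hd R = pt x b"
      using RT SV U by auto
    have aG: "arcs R \<subseteq> G" "arcs S \<subseteq> G" "arcs V \<subseteq> G" using arcs_U RT SV by auto
    let ?D = "rev V @ X @ rev S @ R"
    have "cyc G ?D"
      by (rule cyc4)
        (use RT SV ends XB hdX rung dist aG X_G arcs_rev_G in \<open>simp_all add: hd_rev last_rev Int_Un_distrib Int_Un_distrib2 inf_commute\<close>)
    moreover have "set ?D = set U \<union> set X" using RT SV by auto
    moreover have "arcs V \<union> arcs X \<union> arcs S \<union> arcs R \<subseteq> links ?D"
      using links_append4[of "rev V" X "rev S" R] RT SV XB links_mono_rev[of _ ?D] by simp
    moreover have "arcs U = insert (pt y (b + s), pt y b) (insert (pt y (b + s + t), pt y (b + t))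
        (arcs R \<union> arcs S \<union> arcs V))"
      using RT SV by auto
    moreover have "(pt y b, pt x b) \<in> carcs ?D" "(pt y (b + s), pt x (b + s)) \<in> carcs ?D"
      using RT SV ends XB by (simp_all add: carcs_def hd_rev last_rev)
    ultimately show ?thesis by (intro exI[of _ ?D]) auto
  next
    assume "(pt y (b + s + t), pt y (b + t)) \<in> arcs R"
    then obtain S V where SV: "R = S @ V" "S \<noteq> []" "V \<noteq> []" "last S = pt y (b + s + t)" "hd V = pt y (b + t)"
      by (rule arcs_split)
    have ends: "hd S = pt x b" "last T = pt x (b + s)" "last V = pt y (b + s)"
      using RT SV U by auto
    have aG: "arcs T \<subseteq> G" "arcs S \<subseteq> G" "arcs V \<subseteq> G" using arcs_U RT SV by auto
    let ?D = "S @ rev X @ V @ rev T"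
    have "cyc G ?D"
      by (rule cyc4)
        (use RT SV ends XB hdX rung dist aG X_G arcs_rev_G in \<open>simp_all add: hd_rev last_rev Int_Un_distrib Int_Un_distrib2 inf_commute\<close>)
    moreover have "set ?D = set U \<union> set X" using RT SV by auto
    moreover have "arcs S \<union> arcs X \<union> arcs V \<union> arcs T \<subseteq> links ?D"
      using links_append4[of S "rev X" V "rev T"] RT SV XB links_mono_rev[of _ ?D] by simp
    moreover have "arcs U = insert (pt y (b + s), pt y b) (insert (pt y (b + s + t), pt y (b + t))
        (arcs S \<union> arcs V \<union> arcs T))"
      using RT SV by auto
    moreover have "(pt y b, pt x b) \<in> carcs ?D" "(pt y (b + s), pt x (b + s)) \<in> carcs ?D"
      using RT SV ends XB by (simp_all add: carcs_def hd_rev last_rev)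
    ultimately show ?thesis by (intro exI[of _ ?D]) auto
  qed
  then obtain D where D: "cyc G D" "set D = set U \<union> set X" "arcs X \<subseteq> links D"
      "arcs U - {(pt y (b + s), pt y b), (pt y (b + s + t), pt y (b + t))} \<subseteq> links D"
      "(pt y b, pt x b) \<in> carcs D" "(pt y (b + s), pt x (b + s)) \<in> carcs D" by blast
  have B_not_y: "arcs B \<union> arcs B' \<union> arcs Q \<subseteq> links D"
  proof -
    have "arcs Q \<subseteq> arcs U" "(arcs B)\<inverse> \<subseteq> arcs U" "(arcs B')\<inverse> \<subseteq> arcs U"
      using U_sup by simp_all
    then have sub: "arcs B \<union> arcs B' \<union> arcs Q \<subseteq> arcs U \<union> (arcs U)\<inverse>" by auto
    have "set B \<union> set B' \<union> set Q \<subseteq> set C" unfolding PQ(6) P by auto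
    then have avoid: "z \<notin> set B" "z \<notin> set B'" "z \<notin> set Q" if "z \<in> layer y" for z
      using that C(2) by blast+
    have "(z, pt y j) \<notin> arcs B \<union> arcs B' \<union> arcs Q" "(pt y j, z) \<notin> arcs B \<union> arcs B' \<union> arcs Q" for z j
      using arcs_avoid[OF avoid(1)[of "pt y j"], of z] arcs_avoid[OF avoid(2)[of "pt y j"], of z]
        arcs_avoid[OF avoid(3)[of "pt y j"], of z] by simp_all
    note avoid' = this
    show ?thesis
    proof (rule subrelI)
      fix z z' assume *: "(z, z') \<in> arcs B \<union> arcs B' \<union> arcs Q"
      with sub have "(z, z') \<in> arcs U \<or> (z', z) \<in> arcs U" by blast
      moreover have "z \<noteq> pt y j" "z' \<noteq> pt y j" for j using avoid' * by blast+
      ultimately have "(z, z') \<in> links D \<or> (z', z) \<in> links D" using D(4) by blast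
      then show "(z, z') \<in> links D" using links_sym by metis
    qed
  qed
  show thesis
  proof (rule that[OF D(1) _ _ _ D(5,6)])
    show "set D = set C \<union> layer y" using D(2) set_U by simp
  next
    fix v i assume *: "has C v i" "\<not> (v = x \<and> pt x i \<in> {pt x a, pt x (a + s), pt x b, pt x (b + s)})"
    have "(pt v i, pt v (i + l v)) \<in> (arcs P \<union> arcs Q) \<union> (arcs P \<union> arcs Q)\<inverse>"
      using * PQ(13) unfolding t_def by (intro has_remove2[where a = a and b = "a + s" and x = x]) auto
    then have "(pt v i, pt v (i + l v)) \<in> (arcs B \<union> arcs X \<union> arcs B' \<union> arcs Q) \<union> (arcs B \<union> arcs X \<union> arcs B' \<union> arcs Q)\<inverse>"
      by (rule edge_remove2[where a = b and b = "b + s" and x = x])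
        (use * in \<open>auto simp: arcs_P t_def\<close>)
    then show "has D v i" by (rule hasI) (use B_not_y D(3) in simp)
  next
    fix i assume *: "pt y i \<notin> {pt y a, pt y (a + t), pt y b, pt y (b + t)}"
    then have "(pt y i, pt y (i + s)) \<in> arcs Y \<union> arcs Z" using YZ(13) by simp
    moreover have "(arcs Y)\<inverse> \<subseteq> arcs U" "(arcs Z)\<inverse> \<subseteq> arcs U" using U_sup by simp_all
    ultimately have "(pt y (i + s), pt y i) \<in> arcs U" by auto
    with * D(4) have "(pt y (i + s), pt y i) \<in> links D" by auto
    then show "has D y i" unfolding has_def s_def by (rule links_sym)
  qed
qed


section \<open>Directions in which a cycle traverses a layer\<close>

definition pos :: "('a \<times> int) list \<Rightarrow> 'a \<Rightarrow> int \<Rightarrow> bool" where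
  "pos C v i \<longleftrightarrow> (pt v i, pt v (i + l v)) \<in> carcs C"

lemma not_pos: "has C v i \<Longrightarrow> \<not> pos C v i \<Longrightarrow> (pt v (i + l v), pt v i) \<in> carcs C"
  by (auto simp: pos_def has_def links_def)

lemma has_rev [simp]: "C \<noteq> [] \<Longrightarrow> has (rev C) v i = has C v i"
  by (simp add: has_def)

lemma pos_rev: "cyc G C \<Longrightarrow> has C v i \<Longrightarrow> \<not> pos C v i \<Longrightarrow> pos (rev C) v i"
  using not_pos[of C v i] by (simp add: cyc_def pos_def)

text \<open>The common vertex of two consecutive layer edges is entered by one of them and left by
  the other.\<close>

lemma pos_step:
  assumes "cyc G C" "has C v i" "has C v (i + l v)"
  shows "pos C v i = pos C v (i + l v)"
proof -
  have C: "distinct C" "C \<noteq> []" using assms(1) by (simp_all add: cyc_def)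
  have ne: "pt v (i + l v + l v) \<noteq> pt v i"
    using step_ne[of v "i + l v" v i] by simp
  show ?thesis
  proof (intro iffI; rule ccontr)
    assume "pos C v i" and n: "\<not> pos C v (i + l v)"
    then have "(pt v i, pt v (i + l v)) \<in> carcs C" by (simp add: pos_def)
    from carcs_pred_unique[OF C this not_pos[OF assms(3) n]] ne show False by simp
  next
    assume "pos C v (i + l v)" and n: "\<not> pos C v i"
    then have "(pt v (i + l v), pt v (i + l v + l v)) \<in> carcs C" by (simp add: pos_def)
    from carcs_succ_unique[OF C this not_pos[OF assms(2) n]] ne show False by simp
  qed
qed

text \<open>The vertex spends its successor on the rung, so a layer edge at this vertex can only
  arrive there. \<open>pos_enter\<close> is the mirror image.\<close>

lemma pos_leave:
  assumes "cyc G C" "(pt v i, pt w j) \<in> carcs C" "w \<noteq> v"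
  shows "\<not> pos C v i" "has C v (i - l v) \<Longrightarrow> pos C v (i - l v)"
proof -
  have C: "distinct C" "C \<noteq> []" using assms(1) by (simp_all add: cyc_def)
  have *: "pt w j \<noteq> pt v k" for k using assms(3) by (simp add: pt_eq_iff)
  show "\<not> pos C v i"
  proof
    assume "pos C v i"
    from carcs_succ_unique[OF C assms(2) this[unfolded pos_def]] * show False by metis
  qed
  show "pos C v (i - l v)" if "has C v (i - l v)"
  proof (rule ccontr)
    assume "\<not> pos C v (i - l v)"
    from not_pos[OF that this] have "(pt v i, pt v (i - l v)) \<in> carcs C" by simp
    from carcs_succ_unique[OF C assms(2) this] * show False by metis
  qed
qed

lemma pos_enter:
  assumes "cyc G C" "(pt w j, pt v i) \<in> carcs C" "w \<noteq> v"
  shows "\<not> pos C v (i - l v)"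
proof
  have C: "distinct C" "C \<noteq> []" using assms(1) by (simp_all add: cyc_def)
  have *: "pt w j \<noteq> pt v k" for k using assms(3) by (simp add: pt_eq_iff)
  assume "pos C v (i - l v)"
  then have "(pt v (i - l v), pt v i) \<in> carcs C" by (simp add: pos_def)
  from carcs_pred_unique[OF C assms(2) this] * show False by metis
qed

lemma has_set: "cyc G C \<Longrightarrow> has C v i \<Longrightarrow> pt v i \<in> set C \<and> pt v (i + l v) \<in> set C"
  unfolding has_def cyc_def by (elim conjE) (rule links_set)

text \<open>Reversing the cycle exchanges the two patterns of opposite directions, which reduces one
  to the other.\<close>

lemma attach_mixed:
  fixes x y c
  assumes C: "cyc G C" "set C \<inter> layer y = {}" and nb: "nb x y"
    and has: "has C x c" "has C x (c + off (l x) (l y))" "pos C x c \<noteq> pos C x (c + off (l x) (l y))"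
  obtains D where "cyc G D" "set D = set C \<union> layer y"
    "\<And>v i. has C v i \<Longrightarrow> \<not> (v = x \<and> (pt x i = pt x c \<or> pt x i = pt x (c + off (l x) (l y)))) \<Longrightarrow> has D v i"
    "\<And>i. pt y i \<noteq> pt y c \<Longrightarrow> pt y i \<noteq> pt y (c + off (l y) (l x)) \<Longrightarrow> has D y i"
proof (cases "pos C x c")
  case True
  with has(3) have "\<not> pos C x (c + off (l x) (l y))" by simp
  note arc = True[unfolded pos_def] not_pos[OF has(2) this]
  show thesis by (rule attach_opp[OF C nb arc]) (rule that)
next
  case False
  with has(3) have "pos C x (c + off (l x) (l y))" by simp
  with not_pos[OF has(1) False] C(1)
  have arc: "(pt x c, pt x (c + l x)) \<in> carcs (rev C)"
    "(pt x (c + off (l x) (l y) + l x), pt x (c + off (l x) (l y))) \<in> carcs (rev C)"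
    by (simp_all add: cyc_def pos_def)
  have C': "cyc G (rev C)" "set (rev C) \<inter> layer y = {}" "C \<noteq> []"
    using C cyc_rev[OF sym_G] by (simp_all add: cyc_def)
  obtain D where "cyc G D" "set D = set (rev C) \<union> layer y"
    "\<And>v i. has (rev C) v i \<Longrightarrow> \<not> (v = x \<and> (pt x i = pt x c \<or> pt x i = pt x (c + off (l x) (l y)))) \<Longrightarrow>
       has D v i"
    "\<And>i. pt y i \<noteq> pt y c \<Longrightarrow> pt y i \<noteq> pt y (c + off (l y) (l x)) \<Longrightarrow> has D y i"
    by (rule attach_opp[OF C'(1,2) nb arc]) (rule that)
  with C'(3) show thesis by (intro that[of D]) simp_all
qed

text \<open>
  The edges up to the height \<open>R\<close> form the window that stays available when vertices get attached
  above \<open>R\<close>.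
\<close>

definition good :: "'a set \<Rightarrow> int \<Rightarrow> ('a \<times> int) list \<Rightarrow> bool" where
  "good S R C \<longleftrightarrow> cyc G C \<and> set C = S \<times> {0..<int p} \<and>
     (\<forall>v\<in>S. \<forall>i. 0 \<le> i \<longrightarrow> i + l v \<le> R \<longrightarrow> has C v i)"

lemma good_rev: "good S R C \<Longrightarrow> good S R (rev C)"
  using cyc_rev[OF sym_G, of C] by (auto simp: good_def cyc_def)

lemma good_disjoint: "good S R C \<Longrightarrow> y \<notin> S \<Longrightarrow> set C \<inter> layer y = {}"
  by (auto simp: good_def layer_def)

lemma good_has: "good S R C \<Longrightarrow> v \<in> S \<Longrightarrow> 0 \<le> i \<Longrightarrow> i + l v \<le> R \<Longrightarrow> has C v i"
  by (simp add: good_def)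

section \<open>Attaching vertices in pairs\<close>

lemma off_bounds:
  assumes "l u \<le> L" "l v \<le> L"
  shows "0 < off (l u) (l v)" "off (l u) (l v) \<noteq> l u" "off (l u) (l v) \<le> 2 * L"
  using l_pos[of u] l_pos[of v] assms by (auto simp: off_def)

lemma pt_ne: "i \<noteq> j \<Longrightarrow> 0 \<le> i \<Longrightarrow> 0 \<le> j \<Longrightarrow> i < int p \<Longrightarrow> j < int p \<Longrightarrow> pt v i \<noteq> pt v j"
  by (simp add: pt_near)

text \<open>The leaf \<open>y\<close> is attached at \<open>a\<close> whatever the directions are.
  If the cycle splits, the edges of \<open>x\<close> are coloured by the cycle that contains them;
  if not, by their direction. Either colour changes across the gap at \<open>a\<close>, and
  \<open>shifted_gap\<close> turns this into a place for \<open>z\<close>.\<close>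

lemma add_two_leaves:
  assumes C: "good S (R + K) C" and x: "x \<in> S" and y: "y \<notin> S" "nb x y"
    and z: "z \<notin> S" "nb x z" "z \<noteq> y"
    and L: "l x \<le> L" "l y \<le> L" "l z \<le> L" and R: "0 \<le> R" "R + K < int p"
    and LL: "20 * L \<le> K"
  shows "\<exists>D. good (insert y (insert z S)) R D"
proof -
  \<comment> \<open>The edges used for \<open>z\<close> start at most \<open>2 * L\<close> below
    \<open>a\<close>, so the distance \<open>4 * L\<close> from \<open>R\<close> leaves the low
    window untouched.\<close>
  define a t d e where "a = R + 4 * L" and "t = l x" and "d = off (l x) (l y)" and "e = off (l x) (l z)"
  have L0: "0 < L" using L(1) l_pos[of x] by linarith
  have pos: "0 < t" "0 < d" "d \<noteq> t" "0 < e" "t \<le> L" "d \<le> 2 * L" "e \<le> 2 * L" "0 < l z"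
    using off_bounds[OF L(1,2)] off_bounds[OF L(1,3)] l_pos L by (auto simp: t_def d_def e_def)
  note ne = pt_ne[where v = x]
  have xyz: "x \<noteq> y" "x \<noteq> z" using x y z by auto
  obtain C where C: "good S (R + K) C" and a: "pos C x a"
  proof (cases "pos C x a")
    case False
    have "has C x a" using L0 L(1) LL pos R by (intro good_has[OF C x]) (auto simp: a_def)
    with False C have "pos (rev C) x a" by (intro pos_rev) (simp_all add: good_def)
    with good_rev[OF C] that show thesis by blast
  qed (use C that in blast)
  have cyc: "cyc G C" and dj: "set C \<inter> layer y = {}" "set C \<inter> layer z = {}"
    using C good_disjoint y z by (auto simp: good_def)
  have set_C: "set C = S \<times> {0..<int p}" using C by (simp add: good_def)
  have has_x: "has C x i" if "0 \<le> i" "i \<le> a + 8 * L" for i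
    using that LL L(1) L0 by (intro good_has[OF C x]) (auto simp: a_def)
  have has_low: "has C v i" if "v \<in> S" "0 \<le> i" "i + l v \<le> R" for v i
    using that LL L0 by (intro good_has[OF C]) auto
  have a_p: "a + 10 * L < int p" using LL R(2) L0 by (simp add: a_def)
  show ?thesis
  proof (cases "pos C x (a + d)")
    case True
    obtain D D' where D: "cyc G D" "cyc G D'" "set D \<inter> set D' = {}" "set D \<union> set D' = set C \<union> layer y"
      "pt x (a + t) \<in> set D" "pt x (a + d) \<in> set D" "pt x a \<in> set D'"
      "pt y (a + d) \<in> set D" "pt y (a + t) \<in> set D" "pt y a \<in> set D'"
      "\<And>v i. has C v i \<Longrightarrow> \<not> (v = x \<and> (pt x i = pt x a \<or> pt x i = pt x (a + d))) \<Longrightarrow>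
         has D v i \<or> has D' v i"
      "\<And>i. pt y i \<noteq> pt y a \<Longrightarrow> pt y i \<noteq> pt y (a + off (l y) (l x)) \<Longrightarrow> has D y i \<or> has D' y i"
      unfolding t_def d_def
      by (rule attach_same[OF cyc dj(1) y(2) a[unfolded pos_def] True[unfolded pos_def d_def]]) (rule that[unfolded t_def d_def])
    have col: "has D x i \<or> has D' x i" if "0 \<le> i" "i \<le> a + 8 * L" "i \<notin> {a, a + d}" for i
      by (rule D(11)) (use that has_x a_p pos R L0 ne[of i a] ne[of i "a + d"] in \<open>auto simp: a_def\<close>)
    note sD = has_set[OF D(1)] and sD' = has_set[OF D(2)]
    have inD: "has D x i" if "has D x i \<or> has D' x i" "pt x i \<in> set D \<or> pt x (i + t) \<in> set D" for i
      using that sD'[of x i] D(3) unfolding t_def by blast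
    have ninD: "\<not> has D x i" if "pt x i \<in> set D' \<or> pt x (i + t) \<in> set D'" for i
      using that sD[of x i] D(3) unfolding t_def by blast
    \<comment> \<open>The colour is membership in \<open>D\<close> as opposed to \<open>D'\<close>.
      The edge at \<open>a - t\<close> ends in the vertex \<open>a\<close> of \<open>D'\<close>, and
      the edge at \<open>a + t\<close> begins in a vertex of \<open>D\<close>.\<close>
    obtain c where c: "a - t - l z \<le> c" "c \<le> a + t" "c + e \<le> a + t + l z"
      "c \<notin> {a, a + d}" "c + e \<notin> {a, a + d}" "has D x c \<noteq> has D x (c + e)"
      unfolding e_def t_def[symmetric]
    proof (rule shifted_gap[where g = "has D x" and a = a and t = t and d = d and r = "l z"])
      fix i assume *: "a - t - l z \<le> i" "i \<le> a + l z" "i \<notin> {a, a + d}" "i + t \<notin> {a, a + d}"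
      have "has D x i \<or> has D' x i" "has D x (i + t) \<or> has D' x (i + t)"
        by (rule col; use * pos L R L0 in \<open>auto simp: a_def\<close>)+
      then show "has D x i = has D x (i + t)"
        using inD[of "i + t"] inD[of i] sD[of x i] sD[of x "i + t"] unfolding t_def by blast
    next
      have "has D x (a + t)" using pos L R L0 D(5) by (intro inD col) (auto simp: a_def)
      moreover have "\<not> has D x (a - t)" using D(7) by (intro ninD) simp
      ultimately show "has D x (a - t) \<noteq> has D x (a + t)" by simp
    next
      assume "t = 2 * d"
      \<comment> \<open>The edge at \<open>a - t + d\<close> ends in \<open>a + d\<close>, which
        lies on \<open>D\<close>.\<close>
      have "a - t + d + t = a + d" by simp
      then have "pt x (a - t + d) \<in> set D \<or> pt x (a - t + d + t) \<in> set D" using D(6) by simp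
      then have "has D x (a - t + d)"
        by (intro inD col) (use \<open>t = 2 * d\<close> pos L R L0 in \<open>auto simp: a_def\<close>)
      moreover have "\<not> has D x (a - t)" using D(7) by (intro ninD) simp
      ultimately show "has D x (a - t + d) \<noteq> has D x (a - t)" by simp
    qed (use pos in auto)
    have "R < c" "R < c + e" "c < int p" "c + e < int p"
      using c pos a_p L by (auto simp: a_def)
    note cR = this
    have djz: "(set D \<union> set D') \<inter> layer z = {}" using D(4) dj z(3) by (auto simp: layer_def)
    have "has D x c \<and> has D' x (c + e) \<or> has D' x c \<and> has D x (c + e)"
      using c(4-6) col[of c] col[of "c + e"] cR c(2,3) R pos L by auto
    then obtain E E' where E: "E = D \<and> E' = D' \<or> E = D' \<and> E' = D" "has E x c" "has E' x (c + e)"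
      by blast
    have cE: "cyc G E" "cyc G E'" and djE: "set E \<inter> set E' = {}" "(set E \<union> set E') \<inter> layer z = {}"
      using E(1) D(1-3) djz by auto
    obtain F where F: "cyc G F" "set F = set E \<union> set E' \<union> layer z"
      "\<And>u i. has E u i \<or> has E' u i \<Longrightarrow> \<not> (u = x \<and> (pt x i = pt x c \<or> pt x i = pt x (c + e))) \<Longrightarrow> has F u i"
      "\<And>i. pt z i \<noteq> pt z c \<Longrightarrow> pt z i \<noteq> pt z (c + off (l z) (l x)) \<Longrightarrow> has F z i"
      unfolding e_def by (rule attach_join[OF cE djE z(2) E(2) E(3)[unfolded e_def]]) (rule that[unfolded e_def])
    have "good (insert y (insert z S)) R F"
      unfolding good_def
    proof (intro conjI ballI allI impI)
      show "set F = insert y (insert z S) \<times> {0..<int p}"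
        using F(2) E(1) D(4) set_C by (auto simp: layer_def)
      fix v i assume v: "v \<in> insert y (insert z S)" "0 \<le> i" "i + l v \<le> R"
      have i: "i < R" using l_pos[of v] v by simp
      have far: "pt w i \<noteq> pt w j" if "R < j" "j < int p" for w j
        using that i v by (intro pt_ne) auto
      consider "v = y" | "v = z" | "v \<in> S" "v \<noteq> y" "v \<noteq> z" using v(1) by blast
      then show "has F v i"
      proof cases
        case 1
        have "has D y i \<or> has D' y i"
          using off_bounds[OF L(2,1)] L a_p L0 by (intro D(12) far) (auto simp: a_def)
        with E(1) xyz show ?thesis unfolding 1 by (intro F(3)) auto
      next
        case 2
        show ?thesis unfolding 2
          using off_bounds[OF L(3,1)] L a_p cR c pos by (intro F(4) far) (auto simp: a_def)
      next
        case 3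
        have "has D v i \<or> has D' v i"
          using has_low[of v i] 3 v far a_p L0 pos by (intro D(11)) (auto simp: a_def)
        with E(1) show ?thesis using far cR by (intro F(3)) auto
      qed
    qed (rule F(1))
    then show ?thesis by blast
  next
    case False
    have arc: "(pt x a, pt x (a + t)) \<in> carcs C" "(pt x (a + d + t), pt x (a + d)) \<in> carcs C"
      using a not_pos[OF has_x False] pos R L0 by (auto simp: pos_def t_def a_def)
    obtain D where D: "cyc G D" "set D = set C \<union> layer y"
      "\<And>v i. has C v i \<Longrightarrow> \<not> (v = x \<and> (pt x i = pt x a \<or> pt x i = pt x (a + d))) \<Longrightarrow> has D v i"
      "\<And>i. pt y i \<noteq> pt y a \<Longrightarrow> pt y i \<noteq> pt y (a + off (l y) (l x)) \<Longrightarrow> has D y i"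
      "(pt x a, pt y a) \<in> carcs D" "(pt x (a + t), pt y (a + t)) \<in> carcs D"
      "(pt y (a + d), pt x (a + d)) \<in> carcs D"
      unfolding t_def d_def by (rule attach_opp[OF cyc dj(1) y(2) arc[unfolded t_def d_def]]) (rule that[unfolded t_def d_def])
    have col: "has D x i" if "0 \<le> i" "i \<le> a + 8 * L" "i \<notin> {a, a + d}" for i
      by (rule D(3)) (use that has_x a_p pos R L0 ne[of i a] ne[of i "a + d"] in \<open>auto simp: a_def\<close>)
    have xy: "y \<noteq> x" "z \<noteq> x" using xyz by auto
    \<comment> \<open>The colour is the direction. The cycle leaves \<open>x\<close> at
      \<open>a\<close> and at \<open>a + t\<close>, so the edge below \<open>a\<close> is ascending
      and the edge above \<open>a + t\<close> is not.\<close>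
    obtain c where c: "a - t - l z \<le> c" "c \<le> a + t" "c + e \<le> a + t + l z"
      "c \<notin> {a, a + d}" "c + e \<notin> {a, a + d}" "pos D x c \<noteq> pos D x (c + e)"
      unfolding e_def t_def[symmetric]
    proof (rule shifted_gap[where g = "pos D x" and a = a and t = t and d = d and r = "l z"])
      fix i assume "a - t - l z \<le> i" "i \<le> a + l z" "i \<notin> {a, a + d}" "i + t \<notin> {a, a + d}"
      then show "pos D x i = pos D x (i + t)"
        unfolding t_def using pos L R L0
        by (intro pos_step[OF D(1)] col) (auto simp: a_def t_def)
    next
      have "has D x (a - t)" using pos R L0 by (intro col) (auto simp: a_def)
      with pos_leave(2)[OF D(1,5) xy(1)] have "pos D x (a - t)" by (simp add: t_def)
      moreover have "\<not> pos D x (a + t)" by (rule pos_leave(1)[OF D(1,6) xy(1)])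
      ultimately show "pos D x (a - t) \<noteq> pos D x (a + t)" by simp
    next
      have "has D x (a - t)" using pos R L0 by (intro col) (auto simp: a_def)
      with pos_leave(2)[OF D(1,5) xy(1)] have "pos D x (a - t)" by (simp add: t_def)
      moreover have "\<not> pos D x (a - t + d)" 
        using pos_enter[OF D(1,7) xy(1)] by (simp add: t_def algebra_simps)
      ultimately show "pos D x (a - t + d) \<noteq> pos D x (a - t)" by simp
    qed (use pos in auto)
    have cR: "R < c" "R < c + e" "c < int p" "c + e < int p"
      using c pos a_p L by (auto simp: a_def)
    have djz: "set D \<inter> layer z = {}" using D(2) dj z(3) by (auto simp: layer_def)
    have hc: "has D x c" "has D x (c + e)"
      using c cR R pos L by (auto intro!: col)
    obtain F where F: "cyc G F" "set F = set D \<union> layer z"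
      "\<And>u i. has D u i \<Longrightarrow> \<not> (u = x \<and> (pt x i = pt x c \<or> pt x i = pt x (c + e))) \<Longrightarrow> has F u i"
      "\<And>i. pt z i \<noteq> pt z c \<Longrightarrow> pt z i \<noteq> pt z (c + off (l z) (l x)) \<Longrightarrow> has F z i"
      unfolding e_def by (rule attach_mixed[OF D(1) djz z(2) hc(1) hc(2)[unfolded e_def] c(6)[unfolded e_def]]) (rule that[unfolded e_def])
    have "good (insert y (insert z S)) R F"
      unfolding good_def
    proof (intro conjI ballI allI impI)
      show "set F = insert y (insert z S) \<times> {0..<int p}"
        using F(2) D(2) set_C by (auto simp: layer_def)
      fix v i assume v: "v \<in> insert y (insert z S)" "0 \<le> i" "i + l v \<le> R"
      have i: "i < R" using l_pos[of v] v by simp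
      have far: "pt w i \<noteq> pt w j" if "R < j" "j < int p" for w j
        using that i v by (intro pt_ne) auto
      consider "v = y" | "v = z" | "v \<in> S" "v \<noteq> y" "v \<noteq> z" using v(1) by blast
      then show "has F v i"
      proof cases
        case 1
        have "has D y i"
          using off_bounds[OF L(2,1)] L a_p L0 by (intro D(4) far) (auto simp: a_def)
        with xyz show ?thesis unfolding 1 by (intro F(3)) auto
      next
        case 2
        show ?thesis unfolding 2
          using off_bounds[OF L(3,1)] L a_p cR c pos by (intro F(4) far) (auto simp: a_def)
      next
        case 3
        have "has D v i"
          using has_low[of v i] 3 v far a_p L0 pos by (intro D(3)) (auto simp: a_def)
        then show ?thesis using far cR by (intro F(3)) auto
      qed
    qed (rule F(1))
    then show ?thesis by blast
  qed
qed


text \<open>The place for \<open>z\<close> is now sought on the layer \<open>y\<close>. If attaching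
  \<open>y\<close> splits the cycle, both parts contain edges of \<open>y\<close>. If it does not,
  the steps turn out to be different, and a second, nested attachment of \<open>y\<close> at
  \<open>b\<close> is required to make both directions occur on \<open>y\<close>.\<close>

lemma add_path:
  assumes C: "good S (R + K) C" and x: "x \<in> S" and y: "y \<notin> S" "nb x y"
    and z: "z \<notin> S" "nb y z" "z \<noteq> y"
    and L: "l x \<le> L" "l y \<le> L" "l z \<le> L" and R: "0 \<le> R" "R + K < int p"
    and LL: "20 * L + 5 * L * L \<le> K"
  shows "\<exists>D. good (insert y (insert z S)) R D"
proof -
  define a t s d e f where "a = R + 4 * L" and "t = l x" and "s = l y" and "d = off (l x) (l y)"
    and "e = off (l y) (l x)" and "f = off (l y) (l z)"
  \<comment> \<open>With \<open>5 * L\<close> steps of size at least 1, \<open>b\<close> is so far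
    above \<open>a\<close> that the gaps of \<open>y\<close> at \<open>a\<close> do not interfere.
    As the steps may have size \<open>L\<close>, the window grows by
    \<open>5 * L * L\<close>.\<close>
  define k where "k = nat (5 * L)"
  have L0: "0 < L" using L(1) l_pos[of x] by linarith
  define M where "M = 5 * L * L"
  have LL0: "0 \<le> M" using L0 by (simp add: M_def)
  have LL: "20 * L + M \<le> K" using LL by (simp add: M_def)
  have pos: "0 < t" "0 < s" "0 < d" "0 < e" "e \<noteq> s" "t \<le> L" "s \<le> L" "d \<le> 2 * L" "e \<le> 2 * L"
    "f \<le> 2 * L" "0 < f" "0 < l z"
    using off_bounds[OF L(1,2)] off_bounds[OF L(2,1)] off_bounds[OF L(2,3)] l_pos L
    by (auto simp: t_def s_def d_def e_def f_def)
  have k: "int k = 5 * L" using L0 by (simp add: k_def)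
  have kt: "5 * L \<le> int k * t" "int k * t \<le> M"
    using mult_left_mono[of 1 t "5 * L"] mult_left_mono[of t L "5 * L"] pos L0 unfolding k M_def by simp_all
  have xyz: "x \<noteq> y" "x \<noteq> z" using x y z by auto
  obtain C where C: "good S (R + K) C" and a: "pos C x a"
  proof (cases "pos C x a")
    case False
    have "has C x a" using L0 L(1) LL LL0 pos R by (intro good_has[OF C x]) (auto simp: a_def)
    with False C have "pos (rev C) x a" by (intro pos_rev) (simp_all add: good_def)
    with good_rev[OF C] that show thesis by blast
  qed (use C that in blast)
  have cyc: "cyc G C" and dj: "set C \<inter> layer y = {}" "set C \<inter> layer z = {}"
    using C good_disjoint y z by (auto simp: good_def)
  have set_C: "set C = S \<times> {0..<int p}" using C by (simp add: good_def)
  have has_x: "has C x i" if "0 \<le> i" "i \<le> a + 8 * L + M" for i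
    using that LL L(1) L0 by (intro good_has[OF C x]) (auto simp: a_def)
  have has_low: "has C v i" if "v \<in> S" "0 \<le> i" "i + l v \<le> R" for v i
    using that LL L0 LL0 by (intro good_has[OF C]) auto
  have a_p: "a + 10 * L + M < int p" using LL R(2) L0 by (simp add: a_def)
  show ?thesis
  proof (cases "pos C x (a + d)")
    case True
    obtain D D' where D: "cyc G D" "cyc G D'" "set D \<inter> set D' = {}" "set D \<union> set D' = set C \<union> layer y"
      "pt x (a + t) \<in> set D" "pt x (a + d) \<in> set D" "pt x a \<in> set D'"
      "pt y (a + d) \<in> set D" "pt y (a + t) \<in> set D" "pt y a \<in> set D'"
      "\<And>v i. has C v i \<Longrightarrow> \<not> (v = x \<and> (pt x i = pt x a \<or> pt x i = pt x (a + d))) \<Longrightarrow>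
         has D v i \<or> has D' v i"
      "\<And>i. pt y i \<noteq> pt y a \<Longrightarrow> pt y i \<noteq> pt y (a + e) \<Longrightarrow> has D y i \<or> has D' y i"
      unfolding t_def d_def e_def
      by (rule attach_same[OF cyc dj(1) y(2) a[unfolded pos_def] True[unfolded pos_def d_def]])
        (rule that[unfolded t_def d_def e_def])
    have col: "has D y i \<or> has D' y i" if "0 \<le> i" "i \<le> a + 8 * L" "i \<notin> {a, a + e}" for i
      by (rule D(12); rule pt_ne) (use that a_p LL0 pos R L0 in \<open>auto simp: a_def\<close>)
    note sD = has_set[OF D(1)] and sD' = has_set[OF D(2)]
    have inD: "has D y i" if "has D y i \<or> has D' y i" "pt y i \<in> set D \<or> pt y (i + s) \<in> set D" for i
      using that sD'[of y i] D(3) unfolding s_def by blast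
    have ninD: "\<not> has D y i" if "pt y i \<in> set D' \<or> pt y (i + s) \<in> set D'" for i
      using that sD[of y i] D(3) unfolding s_def by blast
    obtain c where c: "a - s - l z \<le> c" "c \<le> a + s" "c + f \<le> a + s + l z"
      "c \<notin> {a, a + e}" "c + f \<notin> {a, a + e}" "has D y c \<noteq> has D y (c + f)"
      unfolding f_def s_def[symmetric]
    proof (rule shifted_gap[where g = "has D y" and a = a and t = s and d = e and r = "l z"])
      fix i assume *: "a - s - l z \<le> i" "i \<le> a + l z" "i \<notin> {a, a + e}" "i + s \<notin> {a, a + e}"
      have "has D y i \<or> has D' y i" "has D y (i + s) \<or> has D' y (i + s)"
        by (rule col; use * pos L R L0 in \<open>auto simp: a_def\<close>)+
      then show "has D y i = has D y (i + s)"
        using inD[of "i + s"] inD[of i] sD[of y i] sD[of y "i + s"] unfolding s_def by blast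
    next
      \<comment> \<open>The index \<open>a + s\<close> is \<open>a + d\<close> if the steps differ
        and \<open>a + t\<close> if they agree; \<open>D\<close> contains both of these vertices of
        \<open>y\<close>.\<close>
      have "pt y (a + s) \<in> set D" using D(8,9) by (cases "s = t") (auto simp: d_def off_def s_def t_def)
      then have "has D y (a + s)" using pos L R L0 by (intro inD col) (auto simp: a_def)
      moreover have "\<not> has D y (a - s)" using D(10) by (intro ninD) simp
      ultimately show "has D y (a - s) \<noteq> has D y (a + s)" by simp
    next
      assume "s = 2 * e"
      then have "e = t" using pos by (auto simp: e_def off_def s_def t_def split: if_splits)
      have "a - s + e + s = a + e" by simp
      then have "pt y (a - s + e) \<in> set D \<or> pt y (a - s + e + s) \<in> set D" using D(9) \<open>e = t\<close> by simp
      then have "has D y (a - s + e)"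
        by (intro inD col) (use \<open>s = 2 * e\<close> pos L R L0 in \<open>auto simp: a_def\<close>)
      moreover have "\<not> has D y (a - s)" using D(10) by (intro ninD) simp
      ultimately show "has D y (a - s + e) \<noteq> has D y (a - s)" by simp
    qed (use pos in auto)
    have cR: "R < c" "R < c + f" "c < int p" "c + f < int p"
      using c pos a_p LL0 L by (auto simp: a_def s_def)
    have djz: "(set D \<union> set D') \<inter> layer z = {}" using D(4) dj z(3) by (auto simp: layer_def)
    have "has D y c \<or> has D' y c" "has D y (c + f) \<or> has D' y (c + f)"
      by (rule col; use c cR R pos L in auto)+
    with c(6) have "has D y c \<and> has D' y (c + f) \<or> has D' y c \<and> has D y (c + f)" by blast
    then obtain E E' where E: "E = D \<and> E' = D' \<or> E = D' \<and> E' = D" "has E y c" "has E' y (c + f)"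
      by blast
    have cE: "cyc G E" "cyc G E'" and djE: "set E \<inter> set E' = {}" "(set E \<union> set E') \<inter> layer z = {}"
      using E(1) D(1-3) djz by auto
    obtain F where F: "cyc G F" "set F = set E \<union> set E' \<union> layer z"
      "\<And>u i. has E u i \<or> has E' u i \<Longrightarrow> \<not> (u = y \<and> (pt y i = pt y c \<or> pt y i = pt y (c + f))) \<Longrightarrow> has F u i"
      "\<And>i. pt z i \<noteq> pt z c \<Longrightarrow> pt z i \<noteq> pt z (c + off (l z) (l y)) \<Longrightarrow> has F z i"
      unfolding f_def
      by (rule attach_join[OF cE djE z(2) E(2) E(3)[unfolded f_def]]) (rule that[unfolded f_def])
    have "good (insert y (insert z S)) R F"
      unfolding good_def
    proof (intro conjI ballI allI impI)
      show "set F = insert y (insert z S) \<times> {0..<int p}"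
        using F(2) E(1) D(4) set_C by (auto simp: layer_def)
      fix v i assume v: "v \<in> insert y (insert z S)" "0 \<le> i" "i + l v \<le> R"
      have i: "i < R" using l_pos[of v] v by simp
      have far: "pt w i \<noteq> pt w j" if "R < j" "j < int p" for w j
        using that i v by (intro pt_ne) auto
      consider "v = y" | "v = z" | "v \<in> S" "v \<noteq> y" "v \<noteq> z" using v(1) by blast
      then show "has F v i"
      proof cases
        case 1
        have "has D y i \<or> has D' y i"
          using a_p LL0 L0 pos by (intro D(12) far) (auto simp: a_def)
        with E(1) cR far show ?thesis unfolding 1 by (intro F(3)) auto
      next
        case 2
        show ?thesis unfolding 2
          using off_bounds[OF L(3,2)] L a_p LL0 cR c pos by (intro F(4) far) (auto simp: a_def)
      next
        case 3
        have "has D v i \<or> has D' v i"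
          using has_low[of v i] 3 v far a_p LL0 L0 pos by (intro D(11)) (auto simp: a_def)
        with E(1) 3 show ?thesis by (intro F(3)) auto
      qed
    qed (rule F(1))
    then show ?thesis by blast
  next
    case False
    \<comment> \<open>No edge of \<open>x\<close> is missing here, so the direction is constant
      along steps of size \<open>t\<close>. Hence \<open>a + 2 * t\<close> ascends like
      \<open>a\<close>, whereas \<open>a + d\<close> descends. This gives
      \<open>d \<noteq> 2 * t\<close> and excludes both \<open>s = t\<close> and
      \<open>s = 2 * t\<close>.\<close>
    have strand: "pos C x (i + int j * t) = pos C x i"
      if "a \<le> i" "i \<le> a + 2 * L" "j \<le> k" for i j
      using that(3)
    proof (induction j)
      case (Suc j)
      have "int (Suc j) * t \<le> int k * t" "0 \<le> int j * t"
        using Suc.prems pos by (simp_all add: mult_right_mono)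
      then have "has C x (i + int j * t)" "has C x (i + int j * t + t)"
        by (rule_tac [!] has_x; use that kt pos L0 R in \<open>auto simp: a_def algebra_simps\<close>)+
      then have "pos C x (i + int j * t) = pos C x (i + int j * t + t)"
        unfolding t_def by (rule pos_step[OF cyc])
      with Suc show ?case by (simp add: algebra_simps)
    qed simp
    have k2: "2 \<le> k" using L0 by (simp add: k_def)
    have two: "pos C x (a + 2 * t)" using strand[of a 2] a L0 k2 by simp
    have "s \<noteq> t"
    proof
      assume "s = t"
      then have "d = 2 * t" by (simp add: d_def off_def s_def t_def)
      with False two show False by simp
    qed
    then have d: "d = s" by (auto simp: d_def off_def s_def t_def)
    with False two have "s \<noteq> 2 * t" by auto
    note st = \<open>s \<noteq> t\<close> this
    define b where "b = a + int k * t"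
    have up: "(pt x (a + int j * t), pt x (a + int j * t + t)) \<in> carcs C" if "j \<le> k" for j
      using strand[OF _ _ that, of a] a L0 by (simp add: pos_def t_def)
    have down: "(pt x (a + s + int j * t + t), pt x (a + s + int j * t)) \<in> carcs C" if "j \<le> k" for j
    proof -
      have "int j * t \<le> int k * t" "0 \<le> int j * t" using that pos by (simp_all add: mult_right_mono)
      then have "has C x (a + s + int j * t)"
        using kt pos L0 R by (intro has_x; unfold a_def; linarith)
      moreover have "\<not> pos C x (a + s + int j * t)"
        using strand[OF _ _ that, of "a + s"] False pos d by simp
      ultimately show ?thesis unfolding t_def by (rule not_pos)
    qed
    have small: "(int k + 1) * t + s < int p"
      using kt pos a_p R L0 by (simp add: algebra_simps a_def)
    obtain D where D: "cyc G D" "set D = set C \<union> layer y"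
      "\<And>v i. has C v i \<Longrightarrow> \<not> (v = x \<and> pt x i \<in> {pt x a, pt x (a + s), pt x b, pt x (b + s)}) \<Longrightarrow> has D v i"
      "\<And>i. pt y i \<notin> {pt y a, pt y (a + t), pt y b, pt y (b + t)} \<Longrightarrow> has D y i"
      "(pt y b, pt x b) \<in> carcs D" "(pt y (b + s), pt x (b + s)) \<in> carcs D"
      unfolding t_def s_def b_def
      by (rule attach_opp_twice[OF cyc dj(1) y(2) st(1)[unfolded s_def t_def] k2 small[unfolded s_def t_def]
            up[unfolded t_def] down[unfolded s_def t_def]])
        (assumption | rule that[unfolded t_def s_def b_def])+
    have bb: "a + 5 * L \<le> b" "b + 10 * L < int p" "b \<le> a + M"
      using kt a_p LL0 by (simp_all add: b_def)
    have col: "has D y i" if "a + 2 * L \<le> i" "i \<le> b + 8 * L" "i \<notin> {b, b + t}" for i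
    proof -
      have "pt y i \<noteq> pt y a" "pt y i \<noteq> pt y (a + t)" "pt y i \<noteq> pt y b" "pt y i \<noteq> pt y (b + t)"
        by (rule pt_ne; use that bb pos R L0 in \<open>auto simp: a_def\<close>)+
      then show ?thesis by (intro D(4)) simp
    qed
    \<comment> \<open>The roles of the steps are exchanged: the layer \<open>y\<close> has step
      \<open>s\<close> and gaps at \<open>b\<close> and \<open>b + t\<close>. The special case
      \<open>s = 2 * t\<close> of \<open>shifted_gap\<close> is excluded by
      \<open>st\<close>.\<close>
    obtain c where c: "b - s - l z \<le> c" "c \<le> b + s" "c + f \<le> b + s + l z"
      "c \<notin> {b, b + t}" "c + f \<notin> {b, b + t}" "pos D y c \<noteq> pos D y (c + f)"
      unfolding f_def s_def[symmetric]
    proof (rule shifted_gap[where g = "pos D y" and a = b and t = s and d = t and r = "l z"])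
      fix i assume *: "b - s - l z \<le> i" "i \<le> b + l z" "i \<notin> {b, b + t}" "i + s \<notin> {b, b + t}"
      have "has D y i" "has D y (i + s)"
        by (rule col; use * pos L bb in auto)+
      then show "pos D y i = pos D y (i + s)" unfolding s_def by (rule pos_step[OF D(1)])
    next
      have "has D y (b - s)" using pos bb L0 by (intro col) auto
      with pos_leave(2)[OF D(1,5) xyz(1)] have "pos D y (b - s)" by (simp add: s_def)
      moreover have "\<not> pos D y (b + s)" by (rule pos_leave(1)[OF D(1,6) xyz(1)])
      ultimately show "pos D y (b - s) \<noteq> pos D y (b + s)" by simp
    qed (use pos st in auto)
    have cR: "R < c" "R < c + f" "c < int p" "c + f < int p"
      using c pos a_p bb L by (auto simp: a_def)
    have djz: "set D \<inter> layer z = {}" using D(2) dj z(3) by (auto simp: layer_def)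
    have hc: "has D y c" "has D y (c + f)"
      by (rule col; use c bb pos L in auto)+
    obtain F where F: "cyc G F" "set F = set D \<union> layer z"
      "\<And>u i. has D u i \<Longrightarrow> \<not> (u = y \<and> (pt y i = pt y c \<or> pt y i = pt y (c + f))) \<Longrightarrow> has F u i"
      "\<And>i. pt z i \<noteq> pt z c \<Longrightarrow> pt z i \<noteq> pt z (c + off (l z) (l y)) \<Longrightarrow> has F z i"
      unfolding f_def
      by (rule attach_mixed[OF D(1) djz z(2) hc(1) hc(2)[unfolded f_def] c(6)[unfolded f_def]])
        (rule that[unfolded f_def])
    have "good (insert y (insert z S)) R F"
      unfolding good_def
    proof (intro conjI ballI allI impI)
      show "set F = insert y (insert z S) \<times> {0..<int p}"
        using F(2) D(2) set_C by (auto simp: layer_def)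
      fix v i assume v: "v \<in> insert y (insert z S)" "0 \<le> i" "i + l v \<le> R"
      have i: "i < R" using l_pos[of v] v by simp
      have far: "pt w i \<noteq> pt w j" if "R < j" "j < int p" for w j
        using that i v by (intro pt_ne) auto
      have far': "pt w i \<noteq> pt w a" "pt w i \<noteq> pt w (a + t)" "pt w i \<noteq> pt w (a + s)" "pt w i \<noteq> pt w b"
        "pt w i \<noteq> pt w (b + s)" "pt w i \<noteq> pt w (b + t)" for w
        by (rule far; use bb pos L0 in \<open>simp add: a_def\<close>)+
      consider "v = y" | "v = z" | "v \<in> S" "v \<noteq> y" "v \<noteq> z" using v(1) by blast
      then show "has F v i"
      proof cases
        case 1
        have "has D y i" using far' by (intro D(4)) simp
        with cR far show ?thesis unfolding 1 by (intro F(3)) auto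
      next
        case 2
        show ?thesis unfolding 2
          using off_bounds[OF L(3,2)] L bb cR c pos by (intro F(4) far) auto
      next
        case 3
        have "has D v i"
          using has_low[of v i] 3 v far' by (intro D(3)) auto
        with 3 show ?thesis by (intro F(3)) auto
      qed
    qed (rule F(1))
    then show ?thesis by blast
  qed
qed


section \<open>Starting configurations at an edge with equal labels\<close>

lemma merge_layers:
  assumes "cyc G C" "cyc G D" "set C \<inter> set D = {}" "nb x y" "l x = l y" "has C x c" "has D y c"
  obtains F where "cyc G F" "set F = set C \<union> set D"
    "\<And>v i. has C v i \<Longrightarrow> \<not> (v = x \<and> pt x i = pt x c) \<Longrightarrow> has F v i"
    "\<And>v i. has D v i \<Longrightarrow> \<not> (v = y \<and> pt y i = pt y c) \<Longrightarrow> has F v i"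
proof -
  obtain F where F: "cyc G F" "set F = set C \<union> set D"
    "links C - {(pt x c, pt x (c + l x)), (pt x (c + l x), pt x c)} \<subseteq> links F"
    "links D - {(pt y c, pt y (c + l y)), (pt y (c + l y), pt y c)} \<subseteq> links F"
    by (rule cyc_merge[OF sym_G assms(1-3) assms(6)[unfolded has_def] assms(7)[unfolded has_def]])
      (use G_rung[OF assms(4)] assms(5) in auto)
  have keep: "(pt v i, pt v (i + l v)) \<notin> {(pt w c, pt w (c + l w)), (pt w (c + l w), pt w c)}"
    if "\<not> (v = w \<and> pt w i = pt w c)" for v w i
    using that step_eq[of v i w c] step_ne[of v i w c] by auto
  show thesis
    by (rule that[OF F(1,2)]) (use F(3,4) keep in \<open>auto simp: has_def\<close>)
qed

lemma good_fibre: "good {x} R (fibre x)"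
  using cyc_fibre set_fibre by (simp add: good_def layer_def)

lemma good_two:
  assumes "nb x y" "l x = l y" "x \<noteq> y" "0 \<le> R" "R + 1 < int p"
  shows "\<exists>C. good {x, y} R C"
proof -
  have "set (fibre x) \<inter> set (fibre y) = {}" using assms(3) by (auto simp: set_fibre layer_def)
  then obtain F where F: "cyc G F" "set F = set (fibre x) \<union> set (fibre y)"
    "\<And>v i. has (fibre x) v i \<Longrightarrow> \<not> (v = x \<and> pt x i = pt x (R + 1)) \<Longrightarrow> has F v i"
    "\<And>v i. has (fibre y) v i \<Longrightarrow> \<not> (v = y \<and> pt y i = pt y (R + 1)) \<Longrightarrow> has F v i"
    using merge_layers[OF cyc_fibre cyc_fibre _ assms(1,2) has_fibre has_fibre, of "R + 1"] by metis
  have "has F v i" if "v \<in> {x, y}" "0 \<le> i" "i + l v \<le> R" for v i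
  proof -
    have "pt v i \<noteq> pt v (R + 1)"
      using that assms(4,5) l_pos[of v] by (intro pt_ne) auto
    with that(1) F(3)[of x i] F(4)[of y i] show ?thesis by auto
  qed
  moreover have "set F = {x, y} \<times> {0..<int p}" using F(2) by (auto simp: set_fibre layer_def)
  ultimately show ?thesis using F(1) unfolding good_def by blast
qed

lemma fibre_attach:
  assumes "nb x y" "x \<noteq> y"
  obtains D D' where "cyc G D" "cyc G D'" "set D \<inter> set D' = {}" "set D \<union> set D' = layer x \<union> layer y"
    "\<And>i. pt x i \<noteq> pt x a \<Longrightarrow> pt x i \<noteq> pt x (a + off (l x) (l y)) \<Longrightarrow> has D x i \<or> has D' x i"
    "\<And>i. pt y i \<noteq> pt y a \<Longrightarrow> pt y i \<noteq> pt y (a + off (l y) (l x)) \<Longrightarrow> has D y i \<or> has D' y i"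
    "pt x (a + l x) \<in> set D" "pt x a \<in> set D'"
proof -
  have dj: "set (fibre x) \<inter> layer y = {}" using assms(2) by (auto simp: set_fibre layer_def)
  obtain D D' where "cyc G D" "cyc G D'" "set D \<inter> set D' = {}" "set D \<union> set D' = set (fibre x) \<union> layer y"
    "pt x (a + l x) \<in> set D" "pt x (a + off (l x) (l y)) \<in> set D" "pt x a \<in> set D'"
    "pt y (a + off (l x) (l y)) \<in> set D" "pt y (a + l x) \<in> set D" "pt y a \<in> set D'"
    "\<And>v i. has (fibre x) v i \<Longrightarrow> \<not> (v = x \<and> (pt x i = pt x a \<or> pt x i = pt x (a + off (l x) (l y)))) \<Longrightarrow>
       has D v i \<or> has D' v i"
    "\<And>i. pt y i \<noteq> pt y a \<Longrightarrow> pt y i \<noteq> pt y (a + off (l y) (l x)) \<Longrightarrow> has D y i \<or> has D' y i"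
    by (rule attach_same[OF cyc_fibre dj assms(1) fibre_step fibre_step, of a]) (rule that)
  then show thesis using set_fibre by (intro that[of D D']) auto
qed

text \<open>Attaching \<open>u\<close> to the bare layer of \<open>x\<close> gives two cycles, and
  so does attaching \<open>v\<close> to \<open>y\<close>. Equal steps allow merging along squares
  between \<open>x\<close> and \<open>y\<close>: those at \<open>a - t\<close> and
  \<open>a + t\<close> connect \<open>D'\<close> and \<open>D\<close> to the same cycle
  \<open>X\<close>, and one near \<open>b\<close> brings in the remaining cycle
  \<open>W\<close>.\<close>

lemma good_four:
  assumes nb: "nb x y" "nb x u" "nb y v" and eq: "l x = l y" and dist: "distinct [x, y, u, v]"
    and L: "l x \<le> L" "l u \<le> L" "l v \<le> L" and R: "0 \<le> R" "R + 40 * L < int p"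
  shows "\<exists>C. good {x, y, u, v} R C"
proof -
  \<comment> \<open>The attachments are \<open>16 * L\<close> apart, while the offsets are at most
    \<open>2 * L\<close>; so \<open>y\<close> has no gap near \<open>a\<close>, and \<open>x\<close>
    has none near \<open>b\<close>.\<close>
  define t a b where "t = l x" and "a = R + 4 * L" and "b = R + 20 * L"
  have Ly: "l y \<le> L" and ty: "l y = t" using L(1) eq by (simp_all add: t_def)
  have pos: "0 < t" "t \<le> L" using l_pos[of x] L by (simp_all add: t_def)
  note o = off_bounds[OF L(1,2)] off_bounds[OF L(2,1)] off_bounds[OF Ly L(3)] off_bounds[OF L(3) Ly]
  have ne: "x \<noteq> y" "x \<noteq> u" "y \<noteq> v" "u \<noteq> v" "x \<noteq> v" "y \<noteq> u" using dist by auto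
  obtain D D' where D: "cyc G D" "cyc G D'" "set D \<inter> set D' = {}" "set D \<union> set D' = layer x \<union> layer u"
    "\<And>i. pt x i \<noteq> pt x a \<Longrightarrow> pt x i \<noteq> pt x (a + off (l x) (l u)) \<Longrightarrow> has D x i \<or> has D' x i"
    "\<And>i. pt u i \<noteq> pt u a \<Longrightarrow> pt u i \<noteq> pt u (a + off (l u) (l x)) \<Longrightarrow> has D u i \<or> has D' u i"
    "pt x (a + l x) \<in> set D" "pt x a \<in> set D'"
    by (rule fibre_attach[OF nb(2) ne(2), of a]) (rule that)
  obtain E E' where E: "cyc G E" "cyc G E'" "set E \<inter> set E' = {}" "set E \<union> set E' = layer y \<union> layer v"
    "\<And>i. pt y i \<noteq> pt y b \<Longrightarrow> pt y i \<noteq> pt y (b + off (l y) (l v)) \<Longrightarrow> has E y i \<or> has E' y i"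
    "\<And>i. pt v i \<noteq> pt v b \<Longrightarrow> pt v i \<noteq> pt v (b + off (l v) (l y)) \<Longrightarrow> has E v i \<or> has E' v i"
    "pt y (b + l y) \<in> set E" "pt y b \<in> set E'"
    by (rule fibre_attach[OF nb(3) ne(3), of b]) (rule that)
  have hx: "has D x i \<or> has D' x i" if "0 \<le> i" "i \<le> b + 10 * L" "i \<noteq> a" "i \<noteq> a + off (l x) (l u)" for i
    by (rule D(5); rule pt_ne; use that R o pos in \<open>simp add: a_def b_def\<close>)
  have hy: "has E y i \<or> has E' y i" if "0 \<le> i" "i \<le> b + 10 * L" "i \<noteq> b" "i \<noteq> b + off (l y) (l v)" for i
    by (rule E(5); rule pt_ne; use that R o pos in \<open>simp add: a_def b_def\<close>)
  have x1: "has D' x (a - t)"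
  proof -
    have "has D x (a - t) \<or> has D' x (a - t)" by (rule hx) (use R o pos in \<open>simp_all add: a_def b_def\<close>)
    moreover have "\<not> has D x (a - t)"
      using has_set[OF D(1), of x "a - t"] D(3,8) by (auto simp: t_def)
    ultimately show ?thesis by simp
  qed
  have x2: "has D x (a + t)"
  proof -
    have "has D x (a + t) \<or> has D' x (a + t)" by (rule hx) (use R o pos in \<open>simp_all add: a_def b_def t_def\<close>)
    moreover have "\<not> has D' x (a + t)"
      using has_set[OF D(2), of x "a + t"] D(3,7) by (auto simp: t_def)
    ultimately show ?thesis by simp
  qed
  have y1: "has E' y (b - t)"
  proof -
    have "has E y (b - t) \<or> has E' y (b - t)" by (rule hy) (use R o pos in \<open>simp_all add: a_def b_def\<close>)
    moreover have "\<not> has E y (b - t)"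
      using has_set[OF E(1), of y "b - t"] E(3,8) by (auto simp: ty)
    ultimately show ?thesis by simp
  qed
  have y2: "has E y (b + t)"
  proof -
    have "has E y (b + t) \<or> has E' y (b + t)" by (rule hy) (use R o pos in \<open>simp_all add: a_def b_def ty\<close>)
    moreover have "\<not> has E' y (b + t)"
      using has_set[OF E(2), of y "b + t"] E(3,7) by (auto simp: ty)
    ultimately show ?thesis by simp
  qed
  \<comment> \<open>The edges of \<open>y\<close> at \<open>a - t\<close>, \<open>a\<close>,
    \<open>a + t\<close> are consecutive and present, hence on one cycle, which is called
    \<open>X\<close>. The edges at \<open>b - t\<close> and \<open>b + t\<close> lie on
    \<open>E'\<close> and \<open>E\<close>, so one of them is on the other cycle
    \<open>W\<close>.\<close>
  have "\<exists>X W c. {X, W} = {E, E'} \<and> has X y (a - t) \<and> has X y (a + t) \<and> has W y c \<and> c \<in> {b - t, b + t}"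
  proof -
    have "has E y (a - t) \<or> has E' y (a - t)" "has E y a \<or> has E' y a" "has E y (a + t) \<or> has E' y (a + t)"
      by (rule hy; use R o pos in \<open>simp add: a_def b_def\<close>)+
    moreover have "has E y i \<longleftrightarrow> has E y (i + t)" 
      if "has E y i \<or> has E' y i" "has E y (i + t) \<or> has E' y (i + t)" for i
      using that has_set[OF E(1), of y i] has_set[OF E(1), of y "i + t"] has_set[OF E(2), of y i]
        has_set[OF E(2), of y "i + t"] E(3) unfolding ty by blast
    from this[of "a - t"] this[of a] have "has E y (a - t) \<or> has E' y (a - t) \<Longrightarrow>
       has E y a \<or> has E' y a \<Longrightarrow> has E y (a + t) \<or> has E' y (a + t) \<Longrightarrow>
       has E y (a - t) \<longleftrightarrow> has E y (a + t)" by simp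
    ultimately have "has E y (a - t) \<and> has E y (a + t) \<or> has E' y (a - t) \<and> has E' y (a + t)" by blast
    then show ?thesis using y1 y2 by blast
  qed
  then obtain X W c where XW: "{X, W} = {E, E'}" "has X y (a - t)" "has X y (a + t)" "has W y c"
    "c = b - t \<or> c = b + t" by blast
  have cyc: "cyc G X" "cyc G W" and sets: "set X \<inter> set W = {}" "set X \<union> set W = layer y \<union> layer v"
    using XW(1) E(1-4) by (auto simp: doubleton_eq_iff)
  have hXW: "has X w i \<or> has W w i" if "has E w i \<or> has E' w i" for w i
    using XW(1) that by (auto simp: doubleton_eq_iff)
  have dxy: "(set D \<union> set D') \<inter> (set X \<union> set W) = {}"
  proof -
    have "(layer x \<union> layer u) \<inter> (layer y \<union> layer v) = {}" using ne by (auto simp: layer_def)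
    then show ?thesis by (simp only: D(4) sets(2))
  qed
  obtain M where M: "cyc G M" "set M = set D' \<union> set X"
    "\<And>w i. has D' w i \<Longrightarrow> \<not> (w = x \<and> pt x i = pt x (a - t)) \<Longrightarrow> has M w i"
    "\<And>w i. has X w i \<Longrightarrow> \<not> (w = y \<and> pt y i = pt y (a - t)) \<Longrightarrow> has M w i"
    by (rule merge_layers[OF D(2) cyc(1) _ nb(1) eq x1 XW(2)]) (use dxy in auto)
  have far: "pt w i \<noteq> pt w j" if "i \<noteq> j" "0 \<le> i" "0 \<le> j" "i \<le> b + 10 * L" "j \<le> b + 10 * L" for w i j
    by (rule pt_ne) (use that R pos in \<open>auto simp: b_def\<close>)
  have M_y: "has M y (a + t)"
    by (rule M(4)[OF XW(3)]) (use far[of "a + t" "a - t"] R pos in \<open>simp add: a_def b_def\<close>)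
  obtain N where N: "cyc G N" "set N = set D \<union> set M"
    "\<And>w i. has D w i \<Longrightarrow> \<not> (w = x \<and> pt x i = pt x (a + t)) \<Longrightarrow> has N w i"
    "\<And>w i. has M w i \<Longrightarrow> \<not> (w = y \<and> pt y i = pt y (a + t)) \<Longrightarrow> has N w i"
    by (rule merge_layers[OF D(1) M(1) _ nb(1) eq x2 M_y]) (use dxy D(3) M(2) in auto)
  have N_D: "has N w i" if "has D w i \<or> has D' w i"
    "w \<in> {x, y} \<Longrightarrow> pt w i \<noteq> pt w (a - t) \<and> pt w i \<noteq> pt w (a + t)" for w i
    using that M(3)[of w i] N(3)[of w i] N(4)[of w i] by blast
  have N_X: "has N w i" if "has X w i"
    "w \<in> {x, y} \<Longrightarrow> pt w i \<noteq> pt w (a - t) \<and> pt w i \<noteq> pt w (a + t)" for w i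
    using that M(4)[of w i] N(4)[of w i] by blast
  have c: "a + 15 * L \<le> c" "c \<le> b + L" using XW(5) pos by (auto simp: a_def b_def)
  have N_x: "has N x c"
  proof (rule N_D)
    show "has D x c \<or> has D' x c" by (rule hx) (use c R pos o in \<open>simp_all add: a_def b_def\<close>)
    show "pt x c \<noteq> pt x (a - t) \<and> pt x c \<noteq> pt x (a + t)"
      by (intro conjI far) (use c R pos in \<open>simp_all add: a_def b_def\<close>)
  qed
  obtain F where F: "cyc G F" "set F = set N \<union> set W"
    "\<And>w i. has N w i \<Longrightarrow> \<not> (w = x \<and> pt x i = pt x c) \<Longrightarrow> has F w i"
    "\<And>w i. has W w i \<Longrightarrow> \<not> (w = y \<and> pt y i = pt y c) \<Longrightarrow> has F w i"
    by (rule merge_layers[OF N(1) cyc(2) _ nb(1) eq N_x XW(4)]) (use dxy sets M(2) N(2) in auto)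
  have "good {x, y, u, v} R F"
    unfolding good_def
  proof (intro conjI ballI allI impI)
    show "set F = {x, y, u, v} \<times> {0..<int p}"
    proof -
      have "set F = (set D \<union> set D') \<union> (set X \<union> set W)" using F(2) N(2) M(2) by auto
      then show ?thesis unfolding D(4) sets(2) by (auto simp: layer_def)
    qed
    fix w i assume w: "w \<in> {x, y, u, v}" "0 \<le> i" "i + l w \<le> R"
    have i: "i < R" using l_pos[of w] w by simp
    have low: "pt z i \<noteq> pt z j" if "R < j" "j \<le> b + 10 * L" for z j
      by (rule far) (use that i w(2) R pos in \<open>auto simp: b_def\<close>)
    have low': "pt z i \<noteq> pt z (a - t)" "pt z i \<noteq> pt z (a + t)" "pt z i \<noteq> pt z c" "pt z i \<noteq> pt z a"
      "pt z i \<noteq> pt z b" "pt z i \<noteq> pt z (a + off (l x) (l u))" "pt z i \<noteq> pt z (a + off (l u) (l x))"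
      "pt z i \<noteq> pt z (b + off (l y) (l v))" "pt z i \<noteq> pt z (b + off (l v) (l y))" for z
      by (rule low; use c o R pos in \<open>simp add: a_def b_def\<close>)+
    have "has D w i \<or> has D' w i \<or> has E w i \<or> has E' w i"
      using w(1) D(5,6)[of i] E(5,6)[of i] low' by auto
    then consider "has D w i \<or> has D' w i" | "has X w i" | "has W w i" using hXW by blast
    then show "has F w i"
      by cases (use low' N_D[of w i] N_X[of w i] F(3,4)[of w i] in auto)
  qed (rule F(1))
  then show ?thesis by blast
qed

end

section \<open>Growing the Hamilton cycle along a spanning tree\<close>

locale weighted_graph =
  fixes l :: "'a \<Rightarrow> int" and nb :: "'a \<Rightarrow> 'a \<Rightarrow> bool" and L :: int
  assumes l_pos: "0 < l v" and l_le: "l v \<le> L" and nb_sym: "nb u v \<Longrightarrow> nb v u"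
begin

text \<open>The window \<open>R\<close> is quantified before \<open>N\<close> because an extension
  asks for the larger window \<open>R + K\<close> on the smaller set; the bound on \<open>p\<close>
  may grow with it.\<close>

definition hamlike :: "'a set \<Rightarrow> bool" where
  "hamlike S \<longleftrightarrow> (\<forall>R\<ge>0. \<exists>N. \<forall>p\<ge>N. prime p \<longrightarrow> (\<exists>C. voltage_lift.good p l nb S R C))"

lemma voltage_liftI: "prime p \<Longrightarrow> p > 2 \<Longrightarrow> L < int p \<Longrightarrow> voltage_lift p l nb"
  using l_pos l_le nb_sym by unfold_locales (auto intro: le_less_trans)

lemma hamlike_extend:
  assumes "hamlike S"
    and step: "\<And>p R C. voltage_lift p l nb \<Longrightarrow> 0 \<le> R \<Longrightarrow> R + K < int p \<Longrightarrow>
      voltage_lift.good p l nb S (R + K) C \<Longrightarrow> \<exists>D. voltage_lift.good p l nb T R D"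
    and K: "0 \<le> K"
  shows "hamlike T"
  unfolding hamlike_def
proof (intro allI impI)
  fix R :: int assume R: "0 \<le> R"
  with K have "0 \<le> R + K" by simp
  with assms(1) obtain N where N: "prime p \<Longrightarrow> p \<ge> N \<Longrightarrow> \<exists>C. voltage_lift.good p l nb S (R + K) C" for p
    unfolding hamlike_def by blast
  show "\<exists>N. \<forall>p\<ge>N. prime p \<longrightarrow> (\<exists>C. voltage_lift.good p l nb T R C)"
  proof (rule exI[of _ "N + 3 + nat L + nat (R + K + 1)"], intro allI impI)
    fix p assume p: "p \<ge> N + 3 + nat L + nat (R + K + 1)" and "prime p"
    then have "\<exists>C. voltage_lift.good p l nb S (R + K) C" by (intro N) auto
    moreover have "voltage_lift p l nb" using p \<open>prime p\<close> by (intro voltage_liftI) auto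
    ultimately show "\<exists>C. voltage_lift.good p l nb T R C" using step[of p R] R p by auto
  qed
qed

lemma hamlike_base:
  assumes step: "\<And>p R. voltage_lift p l nb \<Longrightarrow> 0 \<le> R \<Longrightarrow> R + K < int p \<Longrightarrow>
      \<exists>D. voltage_lift.good p l nb T R D"
  shows "hamlike T"
  unfolding hamlike_def
proof (intro allI impI)
  fix R :: int assume R: "0 \<le> R"
  show "\<exists>N. \<forall>p\<ge>N. prime p \<longrightarrow> (\<exists>C. voltage_lift.good p l nb T R C)"
  proof (rule exI[of _ "3 + nat L + nat (R + K + 1)"], intro allI impI)
    fix p assume p: "p \<ge> 3 + nat L + nat (R + K + 1)" and "prime p"
    then have "voltage_lift p l nb" by (intro voltage_liftI) auto
    then show "\<exists>C. voltage_lift.good p l nb T R C" using step[of p R] R p by auto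
  qed
qed

lemma L_nonneg: "0 \<le> L"
  using l_pos[of undefined] l_le[of undefined] by linarith

lemma hamlike_single: "hamlike {x}"
  by (rule hamlike_base[where K = 0]) (meson voltage_lift.good_fibre)

lemma hamlike_two: "nb x y \<Longrightarrow> l x = l y \<Longrightarrow> x \<noteq> y \<Longrightarrow> hamlike {x, y}"
  by (rule hamlike_base[where K = 1]) (rule voltage_lift.good_two)

lemma hamlike_four:
  assumes "nb x y" "nb x u" "nb y v" "l x = l y" "distinct [x, y, u, v]"
  shows "hamlike {x, y, u, v}"
  by (rule hamlike_base[where K = "40 * L"])
    (rule voltage_lift.good_four[OF _ assms l_le[of x] l_le[of u] l_le[of v]])

lemma hamlike_add_leaves:
  assumes "hamlike S" "x \<in> S" "y \<notin> S" "nb x y" "z \<notin> S" "nb x z" "z \<noteq> y"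
  shows "hamlike (insert y (insert z S))"
proof (rule hamlike_extend[OF assms(1), where K = "20 * L"])
  fix p R C
  assume "voltage_lift p l nb" "0 \<le> R" "R + (20 * L) < int p" "voltage_lift.good p l nb S (R + (20 * L)) C"
  then show "\<exists>D. voltage_lift.good p l nb (insert y (insert z S)) R D"
    using assms(2-7) l_le[of x] l_le[of y] l_le[of z] by (intro voltage_lift.add_two_leaves) auto
qed (use L_nonneg in simp)

lemma hamlike_add_path:
  assumes "hamlike S" "x \<in> S" "y \<notin> S" "nb x y" "z \<notin> S" "nb y z" "z \<noteq> y"
  shows "hamlike (insert y (insert z S))"
proof (rule hamlike_extend[OF assms(1), where K = "20 * L + 5 * L * L"])
  fix p R C
  assume "voltage_lift p l nb" "0 \<le> R" "R + (20 * L + 5 * L * L) < int p" "voltage_lift.good p l nb S (R + (20 * L + 5 * L * L)) C"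
  then show "\<exists>D. voltage_lift.good p l nb (insert y (insert z S)) R D"
    using assms(2-7) l_le[of x] l_le[of y] l_le[of z] by (intro voltage_lift.add_path) auto
qed (use L_nonneg in simp)

text \<open>Deepest vertices are leaves. Two of them with the same parent are removed together;
  otherwise a deepest vertex is the only child of its parent, and the two are removed unless the
  parent is an end of the root edge. Measuring the depth from both \<open>x\<close> and
  \<open>y\<close> protects the root edge.\<close>

lemma hamlike_tree:
  fixes dep :: "'a \<Rightarrow> nat" and par :: "'a \<Rightarrow> 'a"
  assumes root: "nb x y" "l x = l y" "x \<noteq> y" "dep x = 0" "dep y = 0"
    and S: "finite S" "x \<in> S" "y \<in> S"
    and par: "\<And>v. v \<in> S \<Longrightarrow> v \<noteq> x \<Longrightarrow> v \<noteq> y \<Longrightarrow> par v \<in> S \<and> nb (par v) v \<and> dep v = Suc (dep (par v))"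
  shows "hamlike S"
  using S par
proof (induction "card S" arbitrary: S rule: less_induct)
  case (less S)
  define T where "T = S - {x, y}"
  have par_T: "par v \<in> S" "nb (par v) v" "dep v = Suc (dep (par v))" if "v \<in> T" for v
    using less.prems(4)[of v] that by (auto simp: T_def)
  have S_eq: "S = insert x (insert y T)" and xyT: "x \<notin> T" "y \<notin> T"
    using less.prems by (auto simp: T_def)
  have fin: "finite T" using less.prems(1) by (simp add: T_def)
  show ?case
  proof (cases "T = {}")
    case True
    then show ?thesis using hamlike_two root S_eq by simp
  next
    case False
    define m where "m = Max (dep ` T)"
    have m_ge: "dep u \<le> m" if "u \<in> T" for u using that fin by (simp add: m_def)
    have "m \<in> dep ` T" unfolding m_def using fin False by (intro Max_in) auto
    then obtain v where v: "v \<in> T" "dep v = m" by auto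
    have IH: "hamlike (S - {u, w})" if "u \<in> T" "w \<in> T" "\<And>z. z \<in> T - {u, w} \<Longrightarrow> par z \<notin> {u, w}" for u w
    proof (rule less.hyps)
      show "card (S - {u, w}) < card S"
        using that less.prems(1) by (intro psubset_card_mono) (auto simp: T_def)
    qed (use that less.prems par_T xyT in \<open>auto simp: T_def\<close>)
    have leaf: "par z \<noteq> u" if "z \<in> T" "u \<in> T" "dep u = m" for z u
      using that par_T(3)[of z] m_ge[of z] by auto
    show ?thesis
    proof (cases "\<exists>u w. u \<in> T \<and> w \<in> T \<and> u \<noteq> w \<and> dep u = m \<and> dep w = m \<and> par u = par w")
      case True
      then obtain u w where uw: "u \<in> T" "w \<in> T" "u \<noteq> w" "dep u = m" "dep w = m" "par u = par w"
        by blast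
      have "hamlike (S - {u, w})" using uw leaf by (intro IH) auto
      then have "hamlike (insert u (insert w (S - {u, w})))"
        using uw leaf par_T[of u] par_T[of w] by (intro hamlike_add_leaves[where x = "par u"]) auto
      moreover have "insert u (insert w (S - {u, w})) = S" using uw by (auto simp: T_def)
      ultimately show ?thesis by simp
    next
      case no_pair: False
      show ?thesis
      proof (cases "\<exists>u\<in>T. dep u = m \<and> par u \<in> T")
        case True
        then obtain u where u: "u \<in> T" "dep u = m" "par u \<in> T" by blast
        have ne: "par u \<noteq> u" using leaf u by blast
        have child: "w = u" if "w \<in> T" "par w = par u" for w
        proof -
          have "dep w = m" using that u par_T(3)[of u] par_T(3)[of w] by simp
          with no_pair that u show ?thesis by blast
        qed
        have "par (par u) \<noteq> par u" using par_T(3)[OF u(3)] by auto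
        moreover have "par (par u) \<noteq> u" using leaf u by blast
        moreover have "hamlike (S - {par u, u})" using u leaf child by (intro IH) blast+
        ultimately have "hamlike (insert (par u) (insert u (S - {par u, u})))"
          using u ne par_T[of u] par_T[of "par u"]
          by (intro hamlike_add_path[where x = "par (par u)"]) auto
        moreover have "insert (par u) (insert u (S - {par u, u})) = S"
          using u by (auto simp: T_def)
        ultimately show ?thesis by simp
      next
        case False
        \<comment> \<open>The deepest level now hangs directly on the root edge, so it is all of
          \<open>T\<close>, with at most one vertex at each end.\<close>
        have "par v \<in> {x, y}" using False v par_T(1)[of v] S_eq by blast
        then have "m = 1" using v par_T(3)[of v] root(4,5) by auto
        have dep1: "dep u = m" if "u \<in> T" for u
          using m_ge[OF that] par_T(3)[OF that] \<open>m = 1\<close> by simp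
        have par_xy: "par u = x \<or> par u = y" if "u \<in> T" for u
          using False that dep1[OF that] par_T(1)[OF that] S_eq by blast
        have inj: "u = w" if "u \<in> T" "w \<in> T" "par u = par w" for u w
          using no_pair that dep1 by blast
        show ?thesis
        proof (cases "\<exists>w\<in>T. w \<noteq> v")
          case True
          then obtain w where w: "w \<in> T" "w \<noteq> v" by blast
          have "par v \<noteq> par w" using inj v w by blast
          then have "T = {v, w}" using v w inj par_xy by blast
          then obtain u u' where u: "T = {u, u'}" "par u = x" "par u' = y" "u \<noteq> u'"
            using par_xy[OF v(1)] par_xy[OF w(1)] \<open>par v \<noteq> par w\<close> w(2) by (metis insert_commute)
          have "hamlike {x, y, u, u'}"
            using u par_T(2)[of u] par_T(2)[of u'] root xyT by (intro hamlike_four) auto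
          then show ?thesis using S_eq u by simp
        next
          case False
          then have T: "T = {v}" using v by blast
          from par_xy[OF v(1)] show ?thesis
          proof
            assume "par v = x"
            \<comment> \<open>Three vertices form a star: \<open>y\<close> and \<open>v\<close> are
              a pair of leaves at the bare layer of \<open>x\<close>.\<close>
            then have "hamlike (insert y (insert v {x}))"
              using hamlike_single root T xyT par_T(2)[OF v(1)]
              by (intro hamlike_add_leaves[where x = x]) auto
            then show ?thesis using S_eq T by (simp add: insert_commute)
          next
            assume "par v = y"
            then have "hamlike (insert x (insert v {y}))"
              using hamlike_single root T xyT par_T(2)[OF v(1)] nb_sym
              by (intro hamlike_add_leaves[where x = y]) auto
            then show ?thesis using S_eq T by (simp add: insert_commute)
          qed
        qed
      qed
    qed
  qed
qed

end

section \<open>From the labelled tree to the normalised lift\<close>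

lemma carcs_nth:
  assumes "i < length w"
  shows "(w ! i, w ! (Suc i mod length w)) \<in> carcs w"
proof (cases "Suc i < length w")
  case True
  then have "zip w (tl w) ! i = (w ! i, w ! Suc i)" "i < length (zip w (tl w))"
    by (auto simp: nth_tl)
  then have "(w ! i, w ! Suc i) \<in> arcs w" unfolding arcs_def by (metis nth_mem)
  then show ?thesis using True by (simp add: carcs_def)
next
  case False
  with assms have "Suc i = length w" by simp
  then have "w \<noteq> []" "i = length w - 1" by auto
  then have "last w = w ! i" "hd w = w ! 0" by (simp_all add: last_conv_nth hd_conv_nth)
  then show ?thesis using \<open>Suc i = length w\<close> by (simp add: carcs_def)
qed

lemma is_cycleI:
  assumes "distinct w" "length w \<ge> 3" "\<And>u v. (u, v) \<in> carcs w \<Longrightarrow> adj u v"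
  shows "is_cycle adj w"
  using assms carcs_nth unfolding is_cycle_def by blast

lemma carcs_map: "w \<noteq> [] \<Longrightarrow> carcs (map f w) = map_prod f f ` carcs w"
proof (induction w)
  case (Cons a w)
  have "arcs (map f w) = map_prod f f ` arcs w" for w
    by (induction w rule: induct_list012) (auto simp: arcs_def)
  then show ?case by (simp add: carcs_def hd_map last_map del: list.map)
qed simp

text \<open>The depth is the distance to the nearer of two roots. The choice \<open>x = y\<close>
  gives an ordinary rooted tree, as used for the bipartition.\<close>

lemma bfs_parent:
  fixes adj :: "'a \<Rightarrow> 'a \<Rightarrow> bool"
  assumes conn: "\<And>v. v \<in> V \<Longrightarrow> (x, v) \<in> {(u, v). adj u v}\<^sup>*"
    and V: "\<And>u v. adj u v \<Longrightarrow> u \<in> V" and xy: "x \<in> V" "y \<in> V"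
  obtains dep :: "'a \<Rightarrow> nat" and par where "dep x = 0" "dep y = 0"
    "\<And>v. v \<in> V \<Longrightarrow> v \<noteq> x \<Longrightarrow> v \<noteq> y \<Longrightarrow> par v \<in> V \<and> adj (par v) v \<and> dep v = Suc (dep (par v))"
proof -
  define r where "r = {(u, v). adj u v}"
  define near where "near v n \<longleftrightarrow> (x, v) \<in> r ^^ n \<or> (y, v) \<in> r ^^ n" for v n
  define dep where "dep v = (LEAST n. near v n)" for v
  have ex: "\<exists>n. near v n" if "v \<in> V" for v
    using conn[OF that] unfolding near_def r_def by (auto dest: rtrancl_imp_relpow)
  have near_dep: "near v (dep v)" if "v \<in> V" for v
    using ex[OF that] unfolding dep_def by (rule LeastI_ex)
  have dep_le: "dep v \<le> n" if "near v n" for v n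
    using that unfolding dep_def by (rule Least_le)
  have "\<exists>u. u \<in> V \<and> adj u v \<and> dep v = Suc (dep u)" if v: "v \<in> V" "v \<noteq> x" "v \<noteq> y" for v
  proof (cases "dep v")
    case 0
    with near_dep[OF v(1)] v show ?thesis by (simp add: near_def)
  next
    case (Suc n)
    with near_dep[OF v(1)] have "near v (Suc n)" by simp
    then obtain u where u: "near u n" "adj u v" unfolding near_def r_def by auto
    have uV: "u \<in> V" using u(2) V by blast
    have "near v (Suc (dep u))" using near_dep[OF uV] u(2) unfolding near_def r_def by auto
    then have "dep v \<le> Suc (dep u)" by (rule dep_le)
    moreover have "dep u \<le> n" using dep_le[OF u(1)] .
    ultimately have "dep v = Suc (dep u)" using Suc by simp
    with u uV show ?thesis by blast
  qed
  then obtain par where "\<And>v. v \<in> V \<Longrightarrow> v \<noteq> x \<Longrightarrow> v \<noteq> y \<Longrightarrow>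
      par v \<in> V \<and> adj (par v) v \<and> dep v = Suc (dep (par v))" by metis
  moreover have "near x 0" "near y 0" by (simp_all add: near_def)
  then have "dep x = 0" "dep y = 0" using dep_le by fastforce+
  ultimately show thesis using that by blast
qed

text \<open>Potentials exist because the spanning tree has no closed walks with a nonzero voltage.\<close>

lemma potential_exists:
  fixes dep :: "'a \<Rightarrow> nat" and w :: "'a \<Rightarrow> int"
  assumes "\<And>v. v \<in> V \<Longrightarrow> v \<noteq> x \<Longrightarrow> v \<noteq> y \<Longrightarrow> par v \<in> V \<and> dep v = Suc (dep (par v))"
    and "dep x = 0" "dep y = 0"
  obtains h where "h x = 0" "h y = c \<or> y = x" "\<And>v. v \<in> V \<Longrightarrow> v \<noteq> x \<Longrightarrow> v \<noteq> y \<Longrightarrow> h v = h (par v) + w v"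
proof -
  \<comment> \<open>Chains of parents end at either root. Prescribing the value at \<open>y\<close>
    as well lets the edge between the roots be normalised.\<close>
  define b where "b v = (if v = x then 0 else c)" for v
  define h where "h v = (\<Sum>k<dep v. w ((par ^^ k) v)) + b ((par ^^ dep v) v)" for v
  have "h v = h (par v) + w v" if "v \<in> V" "v \<noteq> x" "v \<noteq> y" for v
    using assms(1)[OF that] unfolding h_def
    by (simp add: sum.lessThan_Suc_shift funpow_swap1 del: sum.lessThan_Suc)
  moreover have "h x = 0" "h y = c \<or> y = x" using assms by (auto simp: h_def b_def)
  ultimately show thesis using that by blast
qed

section \<open>Equal labels at the ends of an edge\<close>

text \<open>This is the arithmetic-geometric mean inequality for the numbers
  \<open>y b ^ card B\<close>, whose geometric mean is the product on the left.\<close>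

lemma prod_le_mean_power:
  fixes y :: "'b \<Rightarrow> real"
  assumes "finite B" "B \<noteq> {}" "\<And>b. b \<in> B \<Longrightarrow> 0 \<le> y b"
  shows "(\<Prod>b\<in>B. y b) \<le> (\<Sum>b\<in>B. y b ^ card B / card B)"
proof -
  have m: "card B > 0" using assms by (simp add: card_gt_0_iff)
  define z where "z = (\<Prod>b\<in>B. y b)"
  have "0 \<le> z" using assms by (simp add: z_def prod_nonneg)
  then have "z = (z ^ card B) powr (1 / card B)"
    using m by (cases "z = 0") (simp_all add: powr_powr flip: powr_realpow)
  also have "\<dots> = (\<Prod>b\<in>B. y b ^ card B) powr (1 / card B)"
    by (simp add: z_def prod_power_distrib)
  also have "\<dots> \<le> (\<Sum>b\<in>B. y b ^ card B / card B)"
    using arith_geom_mean[of B "\<lambda>b. y b ^ card B"] assms by simp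
  finally show ?thesis unfolding z_def .
qed

text \<open>
  The labels at \<open>\<beta> b\<close> are independent of those at the \<open>\<alpha> b\<close>. By the arithmetic-geometric mean
  inequality the worst case is that all the \<open>\<alpha> b\<close> coincide.
\<close>

lemma prob_all_distinct:
  fixes P :: "'c pmf" and \<alpha> \<beta> :: "'b \<Rightarrow> 'e"
  assumes F: "finite F" and B: "finite B" "B \<noteq> {}"
    and \<alpha>\<beta>: "\<alpha> ` B \<subseteq> F" "\<beta> ` B \<subseteq> F" "inj_on \<beta> B" "\<alpha> ` B \<inter> \<beta> ` B = {}"
  shows "measure_pmf.prob (Pi_pmf F dflt (\<lambda>_. P)) {\<phi>. \<forall>b\<in>B. \<phi> (\<beta> b) \<noteq> \<phi> (\<alpha> b)}
    \<le> measure_pmf.expectation P (\<lambda>c. (1 - pmf P c) ^ card B)"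
proof -
  define F2 F1 where "F2 = \<beta> ` B" and "F1 = F - F2"
  define M1 M2 where "M1 = Pi_pmf F1 dflt (\<lambda>_. P)" and "M2 = Pi_pmf F2 dflt (\<lambda>_. P)"
  define q where "q c = 1 - pmf P c" for c
  have q: "0 \<le> q c" "q c \<le> 1" for c by (simp_all add: q_def pmf_le_1)
  have fin: "finite F1" "finite F2" using F B by (auto simp: F1_def F2_def)
  have un: "F = F1 \<union> F2" using \<alpha>\<beta> by (auto simp: F1_def F2_def)
  have \<alpha>F1: "\<alpha> b \<in> F1" and \<beta>F1: "\<beta> b \<notin> F1" if "b \<in> B" for b
    using that \<alpha>\<beta> by (auto simp: F1_def F2_def)
  define S :: "(('e \<Rightarrow> 'c) \<times> ('e \<Rightarrow> 'c)) set" where "S = {(f, g). \<forall>b\<in>B. g (\<beta> b) \<noteq> f (\<alpha> b)}"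
  \<comment> \<open>With the labels on \<open>F1\<close> fixed, the labels at the different
    \<open>\<beta> b\<close> are independent, and each avoids \<open>f (\<alpha> b)\<close> with
    probability \<open>q (f (\<alpha> b))\<close>.\<close>
  have inner: "emeasure M2 {g. \<forall>b\<in>B. g (\<beta> b) \<noteq> f (\<alpha> b)} = ennreal (\<Prod>b\<in>B. q (f (\<alpha> b)))" for f
  proof -
    have "{g. \<forall>b\<in>B. g (\<beta> b) \<noteq> f (\<alpha> b)} = Pi F2 (\<lambda>e. - {f (\<alpha> (the_inv_into B \<beta> e))})"
      using \<alpha>\<beta>(3) by (auto simp: F2_def the_inv_into_f_f Pi_iff)
    then have "measure_pmf.prob M2 {g. \<forall>b\<in>B. g (\<beta> b) \<noteq> f (\<alpha> b)} =
        (\<Prod>e\<in>F2. measure_pmf.prob P (- {f (\<alpha> (the_inv_into B \<beta> e))}))"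
      unfolding M2_def using measure_Pi_pmf_Pi[OF fin(2)] by simp
    also have "\<dots> = (\<Prod>b\<in>B. measure_pmf.prob P (- {f (\<alpha> b)}))"
      unfolding F2_def using \<alpha>\<beta>(3) by (simp add: prod.reindex the_inv_into_f_f)
    also have "\<dots> = (\<Prod>b\<in>B. q (f (\<alpha> b)))"
    proof (rule prod.cong[OF refl])
      fix b
      show "measure_pmf.prob P (- {f (\<alpha> b)}) = q (f (\<alpha> b))"
        using measure_pmf.prob_compl[of "{f (\<alpha> b)}" P] by (simp add: q_def measure_pmf_single Compl_eq_Diff_UNIV)
    qed
    finally show ?thesis by (simp add: measure_pmf.emeasure_eq_measure)
  qed
  have "emeasure (Pi_pmf F dflt (\<lambda>_. P)) {\<phi>. \<forall>b\<in>B. \<phi> (\<beta> b) \<noteq> \<phi> (\<alpha> b)} = emeasure (pair_pmf M1 M2) S"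
  proof -
    have "(\<lambda>(f, g) x. if x \<in> F1 then f x else g x) -` {\<phi>. \<forall>b\<in>B. \<phi> (\<beta> b) \<noteq> \<phi> (\<alpha> b)} = S"
      using \<alpha>F1 \<beta>F1 by (auto simp: S_def)
    then show ?thesis
      unfolding un M1_def M2_def using Pi_pmf_union[of F1 F2 dflt "\<lambda>_. P"] fin
      by (simp add: F1_def Int_commute)
  qed
  also have "\<dots> = (\<integral>\<^sup>+z. indicator S z \<partial>pair_pmf M1 M2)" by simp
  also have "\<dots> = (\<integral>\<^sup>+f. \<integral>\<^sup>+g. indicator S (f, g) \<partial>M2 \<partial>M1)" by (rule nn_integral_pair_pmf')
  also have "\<dots> = (\<integral>\<^sup>+f. ennreal (\<Prod>b\<in>B. q (f (\<alpha> b))) \<partial>M1)"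
  proof (rule nn_integral_cong)
    fix f
    have "(\<integral>\<^sup>+g. indicator S (f, g) \<partial>M2) = (\<integral>\<^sup>+g. indicator {g. \<forall>b\<in>B. g (\<beta> b) \<noteq> f (\<alpha> b)} g \<partial>M2)"
      by (intro nn_integral_cong) (auto simp: S_def indicator_def)
    then show "(\<integral>\<^sup>+g. indicator S (f, g) \<partial>M2) = ennreal (\<Prod>b\<in>B. q (f (\<alpha> b)))"
      using inner[of f] by simp
  qed
  also have "\<dots> \<le> (\<integral>\<^sup>+f. ennreal (\<Sum>b\<in>B. q (f (\<alpha> b)) ^ card B / card B) \<partial>M1)"
    using prod_le_mean_power[OF B] q by (intro nn_integral_mono ennreal_leI) simp
  also have "\<dots> = (\<integral>\<^sup>+f. (\<Sum>b\<in>B. ennreal (q (f (\<alpha> b)) ^ card B / card B)) \<partial>M1)"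
    using q by (intro nn_integral_cong) (simp add: sum_ennreal)
  also have "\<dots> = (\<Sum>b\<in>B. \<integral>\<^sup>+f. ennreal (q (f (\<alpha> b)) ^ card B / card B) \<partial>M1)"
    by (rule nn_integral_sum) simp
  also have "\<dots> = (\<Sum>b\<in>B. \<integral>\<^sup>+c. ennreal (q c ^ card B / card B) \<partial>P)"
  proof (rule sum.cong[OF refl])
    fix b assume "b \<in> B"
    then have "P = map_pmf (\<lambda>f. f (\<alpha> b)) M1"
      using Pi_pmf_component[OF fin(1), of "\<alpha> b" dflt "\<lambda>_. P"] \<alpha>F1[of b] by (simp add: M1_def)
    then have "(\<integral>\<^sup>+c. ennreal (q c ^ card B / card B) \<partial>P) =
       (\<integral>\<^sup>+c. ennreal (q c ^ card B / card B) \<partial>map_pmf (\<lambda>f. f (\<alpha> b)) M1)" by simp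
    then show "(\<integral>\<^sup>+f. ennreal (q (f (\<alpha> b)) ^ card B / card B) \<partial>M1) = (\<integral>\<^sup>+c. ennreal (q c ^ card B / card B) \<partial>P)"
      by (simp add: nn_integral_map_pmf)
  qed
  also have "\<dots> = of_nat (card B) * (\<integral>\<^sup>+c. ennreal (q c ^ card B / card B) \<partial>P)" by simp
  also have "(\<integral>\<^sup>+c. ennreal (q c ^ card B / card B) \<partial>P) = ennreal (measure_pmf.expectation P (\<lambda>c. q c ^ card B / card B))"
    using q by (intro nn_integral_eq_integral measure_pmf.integrable_const_bound[where B = 1])
      (auto simp: power_le_one divide_le_eq intro!: AE_I2 order.trans[OF power_le_one])
  also have "of_nat (card B) * \<dots> = ennreal (card B * measure_pmf.expectation P (\<lambda>c. q c ^ card B / card B))"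
    by (simp only: ennreal_of_nat_eq_real_of_nat ennreal_mult'[OF of_nat_0_le_iff])
  also have "card B * measure_pmf.expectation P (\<lambda>c. q c ^ card B / card B) = measure_pmf.expectation P (\<lambda>c. q c ^ card B)"
    using B by simp
  finally have "ennreal (measure_pmf.prob (Pi_pmf F dflt (\<lambda>_. P)) {\<phi>. \<forall>b\<in>B. \<phi> (\<beta> b) \<noteq> \<phi> (\<alpha> b)})
      \<le> ennreal (measure_pmf.expectation P (\<lambda>c. q c ^ card B))"
    by (simp add: measure_pmf.emeasure_eq_measure)
  then show ?thesis using q by (simp add: q_def ennreal_le_iff integral_nonneg)
qed

text \<open>On the support the base is below 1, so the powers tend to 0 pointwise. For infinite
  support the base is not bounded away from 1, whence dominated convergence.\<close>

lemma expectation_power_tendsto_0: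
  "(\<lambda>m. measure_pmf.expectation P (\<lambda>c. (1 - pmf P c) ^ m)) \<longlonglongrightarrow> 0"
proof -
  have "(\<lambda>m. measure_pmf.expectation P (\<lambda>c. (1 - pmf P c) ^ m)) \<longlonglongrightarrow> measure_pmf.expectation P (\<lambda>c. 0)"
  proof (rule integral_dominated_convergence[where w = "\<lambda>_. 1"])
    show "AE c in P. (\<lambda>m. (1 - pmf P c) ^ m) \<longlonglongrightarrow> 0"
      by (auto simp: AE_measure_pmf_iff set_pmf_eq pmf_le_1 less_le intro!: LIMSEQ_realpow_zero)
    show "AE c in P. norm ((1 - pmf P c) ^ m) \<le> 1" for m
      by (auto simp: pmf_le_1 power_le_one)
  qed auto
  then show ?thesis by simp
qed

lemma expectation_power_antimono:
  assumes "m \<le> n"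
  shows "measure_pmf.expectation P (\<lambda>c. (1 - pmf P c) ^ n) \<le> measure_pmf.expectation P (\<lambda>c. (1 - pmf P c) ^ m)"
  using assms
  by (intro integral_mono measure_pmf.integrable_const_bound[where B = 1] power_decreasing)
    (auto simp: pmf_le_1 power_le_one)

lemma mod_diff_shift: "((a mod m + h) mod m - (b mod m + g) mod m) mod m = (a + h - (b + g)) mod (m::int)"
  by (simp add: mod_diff_eq mod_add_left_eq)

lemma reflexive_tree_edge:
  assumes "reflexive_tree V E" "{u, v} \<in> E"
  shows "u \<in> V" "v \<in> V"
proof -
  have "E \<subseteq> {{x, y} | x y. x \<in> V \<and> y \<in> V}" using assms(1) by (simp add: reflexive_tree_def)
  from subsetD[OF this assms(2)] obtain a b where "{u, v} = {a, b}" "a \<in> V" "b \<in> V" by auto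
  then have "{u, v} \<subseteq> V" by simp
  then show "u \<in> V" "v \<in> V" by simp_all
qed

lemma reflexive_tree_parent:
  assumes "reflexive_tree V E" "x \<in> V" "y \<in> V"
  obtains dep :: "'a \<Rightarrow> nat" and par where "dep x = 0" "dep y = 0"
    "\<And>v. v \<in> V \<Longrightarrow> v \<noteq> x \<Longrightarrow> v \<noteq> y \<Longrightarrow> par v \<in> V \<and> {par v, v} \<in> E \<and> dep v = Suc (dep (par v))"
proof (rule bfs_parent[of V x "\<lambda>u v. {u, v} \<in> E" y])
  show "(x, v) \<in> {(u, v). {u, v} \<in> E}\<^sup>*" if "v \<in> V" for v
    using assms(1,2) that by (simp add: reflexive_tree_def)
  show "u \<in> V" if "{u, v} \<in> E" for u v by (rule reflexive_tree_edge[OF assms(1) that])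
qed (use assms that in auto)

lemma hamiltonian_lift_if_equal_labels:
  fixes V :: "'a set" and \<phi> :: "'a set \<Rightarrow> int"
  assumes tree: "reflexive_tree V E" and ori: "orientation E ori" and pos: "\<And>e. e \<in> E \<Longrightarrow> 0 < \<phi> e"
    and xy: "x \<in> V" "y \<in> V" "x \<noteq> y" "{x, y} \<in> E" "\<phi> {x} = \<phi> {y}"
  shows "\<exists>N. \<forall>p\<ge>N. prime p \<longrightarrow> hamiltonian (lift_verts p V) (lift_adj p E ori (voltage p \<phi>))"
proof -
  have V: "finite V" "\<And>v. v \<in> V \<Longrightarrow> {v} \<in> E"
    using tree unfolding reflexive_tree_def by blast+
  obtain dep :: "'a \<Rightarrow> nat" and par where dep: "dep x = 0" "dep y = 0"
    and par: "\<And>v. v \<in> V \<Longrightarrow> v \<noteq> x \<Longrightarrow> v \<noteq> y \<Longrightarrow> par v \<in> V \<and> {par v, v} \<in> E \<and> dep v = Suc (dep (par v))"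
    by (rule reflexive_tree_parent[OF tree xy(1,2)]) (rule that)
  \<comment> \<open>The integer voltage of the arc from \<open>u\<close> to \<open>v\<close>, with
    the sign dictated by the orientation.\<close>
  define \<delta> where "\<delta> u v = (if ori {u, v} = (u, v) then \<phi> {u, v} else - \<phi> {u, v})" for u v
  have ori_cases: "ori {u, v} = (u, v) \<or> ori {u, v} = (v, u)" if "{u, v} \<in> E" for u v
    using ori that unfolding orientation_def by (metis doubleton_eq_iff prod.collapse)
  have par': "par v \<in> V \<and> dep v = Suc (dep (par v))" if "v \<in> V" "v \<noteq> x" "v \<noteq> y" for v
    using par[OF that] by blast
  obtain h where h: "h x = 0" "h y = \<delta> x y \<or> y = x"
      "\<And>v. v \<in> V \<Longrightarrow> v \<noteq> x \<Longrightarrow> v \<noteq> y \<Longrightarrow> h v = h (par v) + \<delta> (par v) v"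
  proof (rule potential_exists[of V x y par dep "\<delta> x y" "\<lambda>v. \<delta> (par v) v"])
    show "par v \<in> V \<and> dep v = Suc (dep (par v))" if "v \<in> V" "v \<noteq> x" "v \<noteq> y" for v
      by (rule par'[OF that])
  qed (rule dep(1), rule dep(2), rule that)
  \<comment> \<open>The edges whose voltage the potential cancels; the parent edges and
    \<open>{x, y}\<close> are among them.\<close>
  define nb where "nb u v \<longleftrightarrow> u \<noteq> v \<and> {u, v} \<in> E \<and> h v = h u + \<delta> u v" for u v
  have \<delta>_swap: "\<delta> v u = - \<delta> u v" if "{u, v} \<in> E" "u \<noteq> v" for u v
    using ori_cases[OF that(1)] that(2) by (auto simp: \<delta>_def insert_commute)
  have nb_sym: "nb v u" if "nb u v" for u v
    using that \<delta>_swap[of u v] by (auto simp: nb_def insert_commute)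
  \<comment> \<open>The locale wants positive steps on the whole type, hence the dummy 1, and the
    summand 1 in \<open>L\<close> to dominate it.\<close>
  define l where "l v = (if v \<in> V then \<phi> {v} else 1)" for v
  define L where "L = 1 + (\<Sum>v\<in>V. \<phi> {v})"
  have pos_V: "0 < \<phi> {v}" if "v \<in> V" for v using that V(2) pos by blast
  have sum0: "0 \<le> (\<Sum>v\<in>V. \<phi> {v})" using pos_V by (intro sum_nonneg) (auto intro: less_imp_le)
  have l: "0 < l v" "l v \<le> L" for v
  proof -
    have "\<phi> {v} \<le> (\<Sum>v\<in>V. \<phi> {v})" if "v \<in> V"
      using that V(1) pos_V by (intro member_le_sum) (auto intro: less_imp_le)
    then show "0 < l v" "l v \<le> L" using pos_V sum0 by (auto simp: l_def L_def)
  qed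
  interpret weighted_graph l nb L
    using l nb_sym by unfold_locales auto
  have "hamlike V"
  proof (rule hamlike_tree[where x = x and y = y and dep = dep and par = par])
    show "nb x y" using xy h by (auto simp: nb_def)
    show "l x = l y" using xy by (simp add: l_def)
    fix v assume v: "v \<in> V" "v \<noteq> x" "v \<noteq> y"
    then have "par v \<noteq> v" using par[OF v] by auto
    with par[OF v] h(3)[OF v] show "par v \<in> V \<and> nb (par v) v \<and> dep v = Suc (dep (par v))"
      by (simp add: nb_def)
  qed (use xy dep V in auto)
  then obtain N where N: "prime p \<Longrightarrow> p \<ge> N \<Longrightarrow> \<exists>C. voltage_lift.good p l nb V 0 C" for p
    unfolding hamlike_def by blast
  show ?thesis
  proof (rule exI[of _ "N + 3 + nat L"], intro allI impI)
    fix p assume p: "p \<ge> N + 3 + nat L" and prime: "prime p"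
    interpret voltage_lift p l nb using p prime by (intro voltage_liftI) auto
    obtain C where "good V 0 C" using N[OF prime] p by auto
    then have C: "cyc G C" "set C = V \<times> {0..<int p}" by (simp_all add: good_def)
    then have C': "distinct C" "C \<noteq> []" "carcs C \<subseteq> G" by (simp_all add: cyc_def)
    \<comment> \<open>Undoing the normalisation: shifting each layer by \<open>h v\<close> keeps its
      steps and gives a rung from \<open>u\<close> to \<open>v\<close> the difference
      \<open>h v - h u = \<delta> u v\<close>.\<close>
    define f :: "'a \<times> int \<Rightarrow> 'a \<times> int" where "f = (\<lambda>(v, i). (v, (i + h v) mod int p))"
    have f_pt: "f (pt v i) = (v, (i mod int p + h v) mod int p)" for v i
      by (simp add: f_def pt_def)
    have inj: "inj_on f (V \<times> {0..<int p})"
    proof (rule inj_onI, clarify)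
      fix v i w j assume *: "i \<in> {0..<int p}" "j \<in> {0..<int p}" "f (v, i) = f (w, j)"
      then have "v = w" and "(i + h v) mod int p = (j + h v) mod int p" by (auto simp: f_def)
      then have "int p dvd (i - j)" by (simp add: mod_eq_dvd_iff)
      with * have "i = j" using dvd_imp_le_int[of "i - j" "int p"] by fastforce
      with \<open>v = w\<close> show "v = w \<and> i = j" by simp
    qed
    have fin: "finite (V \<times> {0..<int p})" using V(1) by simp
    have "f ` (V \<times> {0..<int p}) \<subseteq> V \<times> {0..<int p}" using p by (auto simp: f_def)
    from endo_inj_surj[OF fin this inj] have img: "f ` (V \<times> {0..<int p}) = V \<times> {0..<int p}" .
    have len: "length C \<ge> 3"
    proof -
      have "card V \<ge> 1" using V(1) xy(1) by (metis One_nat_def Suc_leI card_gt_0_iff empty_iff)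
      then have "1 * p \<le> card V * p" by (rule mult_le_mono1)
      moreover have "length C = card V * p"
        using distinct_card[OF C'(1)] C(2) by (simp add: card_cartesian_product)
      ultimately show ?thesis using p by linarith
    qed
    have adj: "lift_adj p E ori (voltage p \<phi>) (f z) (f z')" if "(z, z') \<in> carcs C" for z z'
    proof -
      have zV: "fst z \<in> V" using that C(2) carcs_set[OF C'(2)] by fastforce
      have "(z, z') \<in> G" using that C'(3) by blast
      then consider (up) v i where "z = pt v i" "z' = pt v (i + l v)"
        | (down) v i where "z = pt v (i + l v)" "z' = pt v i"
        | (rung) u v i where "z = pt u i" "z' = pt v i" "nb u v"
        unfolding G_def by blast
      then show ?thesis
      proof cases
        case up
        then have v: "v \<in> V" using zV by (simp add: pt_def)
        then have "ori {v} = (v, v)" using ori_cases[of v v] V(2) by auto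
        with v V(2) up show ?thesis
          unfolding lift_adj_def f_pt
          by (intro bexI[of _ "Pos {v}"]) (auto simp: f_pt mod_diff_shift l_def arcs_of_def)
      next
        case down
        then have v: "v \<in> V" using zV by (simp add: pt_def)
        then have "ori {v} = (v, v)" using ori_cases[of v v] V(2) by auto
        with v V(2) down show ?thesis
          unfolding lift_adj_def f_pt
          by (intro bexI[of _ "Neg {v}"]) (auto simp: f_pt mod_diff_shift l_def arcs_of_def)
      next
        case rung
        then have e: "{u, v} \<in> E" "u \<noteq> v" "h v = h u + \<delta> u v" by (auto simp: nb_def)
        from ori_cases[OF e(1)] show ?thesis
        proof
          assume "ori {u, v} = (u, v)"
          with e rung show ?thesis
            unfolding lift_adj_def
            by (intro bexI[of _ "Pos {u, v}"]) (auto simp: f_pt mod_diff_shift \<delta>_def arcs_of_def)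
        next
          assume "ori {u, v} = (v, u)"
          with e rung show ?thesis
            unfolding lift_adj_def
            by (intro bexI[of _ "Neg {u, v}"]) (auto simp: f_pt mod_diff_shift \<delta>_def arcs_of_def)
        qed
      qed
    qed
    have "is_cycle (lift_adj p E ori (voltage p \<phi>)) (map f C)"
    proof (rule is_cycleI)
      show "distinct (map f C)" using C'(1) inj C(2) by (simp add: distinct_map)
      show "length (map f C) \<ge> 3" using len by simp
      show "lift_adj p E ori (voltage p \<phi>) u v" if "(u, v) \<in> carcs (map f C)" for u v
        using that adj unfolding carcs_map[OF C'(2)] by auto
    qed
    moreover have "set (map f C) = lift_verts p V" using img C(2) by (simp add: lift_verts_def)
    ultimately show "hamiltonian (lift_verts p V) (lift_adj p E ori (voltage p \<phi>))"
      unfolding hamiltonian_def by blast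
  qed
qed

text \<open>The larger side of the bipartition of the tree serves as \<open>B\<close>.\<close>

lemma half_with_neighbours:
  assumes tree: "reflexive_tree V E" and card: "card V \<ge> 2"
  obtains B nbr where "B \<subseteq> V" "card V div 2 \<le> card B"
    "\<And>b. b \<in> B \<Longrightarrow> nbr b \<in> V - B \<and> {nbr b, b} \<in> E"
proof -
  have V: "finite V" "V \<noteq> {}" using tree unfolding reflexive_tree_def by blast+
  obtain r where r: "r \<in> V" using V(2) by blast
  obtain dep :: "'a \<Rightarrow> nat" and par where dep: "dep r = 0" "dep r = 0"
    and par': "\<And>v. v \<in> V \<Longrightarrow> v \<noteq> r \<Longrightarrow> v \<noteq> r \<Longrightarrow> par v \<in> V \<and> {par v, v} \<in> E \<and> dep v = Suc (dep (par v))"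
    by (rule reflexive_tree_parent[OF tree r r]) (rule that)
  have par: "par v \<in> V" "{par v, v} \<in> E" "dep v = Suc (dep (par v))" if "v \<in> V" "v \<noteq> r" for v
    using par'[OF that(1,2,2)] by simp_all
  have "\<exists>u\<in>V. u \<noteq> r"
  proof (rule ccontr)
    assume "\<not> ?thesis"
    then have "V = {r}" using r by blast
    with card show False by simp
  qed
  then obtain u where u: "u \<in> V" "u \<noteq> r" by blast
  obtain s where s: "s \<in> V" "dep s = 1" "{s, r} \<in> E"
  proof -
    \<comment> \<open>A vertex of least depth other than \<open>r\<close> has \<open>r\<close> as
      its parent; it supplies a neighbour of opposite parity for the root, which has no
      parent.\<close>
    define s where "s = arg_min dep (\<lambda>v. v \<in> V \<and> v \<noteq> r)"
    have s: "s \<in> V" "s \<noteq> r" and min: "\<And>v. v \<in> V \<Longrightarrow> v \<noteq> r \<Longrightarrow> dep s \<le> dep v"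
      using arg_min_nat_lemma[of "\<lambda>v. v \<in> V \<and> v \<noteq> r" u dep] u by (auto simp: s_def)
    have "par s = r" using par[OF s] min[of "par s"] by auto
    with par[OF s] s dep show thesis by (intro that[of s]) (auto simp: insert_commute)
  qed
  define B0 B1 where "B0 = {v \<in> V. even (dep v)}" and "B1 = {v \<in> V. odd (dep v)}"
  define nbr where "nbr v = (if v = r then s else par v)" for v
  have nbr: "nbr v \<in> V" "{nbr v, v} \<in> E" "even (dep (nbr v)) \<longleftrightarrow> odd (dep v)" if "v \<in> V" for v
    using par[OF that] s dep by (auto simp: nbr_def)
  have "V = B0 \<union> B1" "B0 \<inter> B1 = {}" by (auto simp: B0_def B1_def)
  then have "card V = card B0 + card B1" using V(1) by (metis card_Un_disjoint finite_Un)
  then consider "card V div 2 \<le> card B0" | "card V div 2 \<le> card B1" by linarith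
  then show thesis
  proof cases
    case 1
    then show thesis using nbr by (intro that[of B0 nbr]) (auto simp: B0_def)
  next
    case 2
    then show thesis using nbr by (intro that[of B1 nbr]) (auto simp: B1_def)
  qed
qed

theorem theorem5:
  fixes P :: "int pmf"
    and V :: "nat \<Rightarrow> 'a set"
    and E :: "nat \<Rightarrow> 'a set set"
    and ori :: "nat \<Rightarrow> 'a set \<Rightarrow> 'a \<times> 'a"
  assumes "set_pmf P \<subseteq> {1..}"
    and "\<And>n. n \<ge> 1 \<Longrightarrow> reflexive_tree (V n) (E n)"
    and "\<And>n. n \<ge> 1 \<Longrightarrow> card (V n) = n"
    and "\<And>n. n \<ge> 1 \<Longrightarrow> orientation (E n) (ori n)"
  shows "(\<lambda>n. measure_pmf.prob (random_labelling (E n) P)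
            {\<phi>. \<exists>N::nat. \<forall>p\<ge>N. prime p \<longrightarrow>
                 hamiltonian (lift_verts p (V n)) (lift_adj p (E n) (ori n) (voltage p \<phi>))})
         \<longlonglongrightarrow> 1"
proof -
  define A where "A n = {\<phi>. \<exists>N::nat. \<forall>p\<ge>N. prime p \<longrightarrow>
     hamiltonian (lift_verts p (V n)) (lift_adj p (E n) (ori n) (voltage p \<phi>))}" for n
  define \<psi> where "\<psi> m = measure_pmf.expectation P (\<lambda>c. (1 - pmf P c) ^ m)" for m
  have bound: "1 - \<psi> (n div 2) \<le> measure_pmf.prob (random_labelling (E n) P) (A n)" if n: "n \<ge> 2" for n
  proof -
    have tree: "reflexive_tree (V n) (E n)" and card: "card (V n) = n"
      and ori: "orientation (E n) (ori n)" using assms(2-4) n by auto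
    have V: "finite (V n)" "E n \<subseteq> {{x, y} | x y. x \<in> V n \<and> y \<in> V n}" "\<And>v. v \<in> V n \<Longrightarrow> {v} \<in> E n"
      using tree unfolding reflexive_tree_def by blast+
    have "E n \<subseteq> Pow (V n)" using V(2) by auto
    then have finE: "finite (E n)" using V(1) finite_subset by blast
    obtain B nbr where B: "B \<subseteq> V n" "n div 2 \<le> card B"
      "\<And>b. b \<in> B \<Longrightarrow> nbr b \<in> V n - B \<and> {nbr b, b} \<in> E n"
      using half_with_neighbours[OF tree] card n by metis
    have fB: "finite B" using B(1) V(1) finite_subset by blast
    have "card B > 0" using B(2) n by linarith
    then have "B \<noteq> {}" by auto
    let ?M = "random_labelling (E n) P"
    \<comment> \<open>Each vertex of \<open>B\<close> is compared with one neighbour outside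
      \<open>B\<close> only, so that the loops at \<open>B\<close> are disjoint from the loops they
      are compared with.\<close>
    define Z where "Z = {\<phi> :: 'a set \<Rightarrow> int. \<forall>b\<in>B. \<phi> {b} \<noteq> \<phi> {nbr b}}"
    have edges: "(\<lambda>b. {nbr b}) ` B \<subseteq> E n" "(\<lambda>b. {b}) ` B \<subseteq> E n" "inj_on (\<lambda>b. {b}) B"
      "(\<lambda>b. {nbr b}) ` B \<inter> (\<lambda>b. {b}) ` B = {}"
      using B(1) V(3) by (auto simp: inj_on_def dest: B(3))
    have "measure_pmf.prob ?M Z \<le> \<psi> (card B)"
      unfolding Z_def \<psi>_def random_labelling_def
      by (rule prob_all_distinct[OF finE fB \<open>B \<noteq> {}\<close> edges])
    also have "\<dots> \<le> \<psi> (n div 2)" unfolding \<psi>_def by (rule expectation_power_antimono[OF B(2)])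
    finally have Z: "measure_pmf.prob ?M Z \<le> \<psi> (n div 2)" .
    \<comment> \<open>The inclusion holds only almost surely, because labels are positive on the
      support of the law but not for arbitrary functions.\<close>
    have "AE \<phi> in ?M. \<phi> \<in> - Z \<longrightarrow> \<phi> \<in> A n"
    proof (rule AE_pmfI, rule impI)
      fix \<phi> assume \<phi>: "\<phi> \<in> set_pmf ?M" "\<phi> \<in> - Z"
      have pos: "0 < \<phi> e" if "e \<in> E n" for e
        using set_Pi_pmf_subset'[OF finE, of 0 "\<lambda>_. P"] \<phi>(1) that assms(1)
        unfolding random_labelling_def PiE_dflt_def by fastforce
      from \<phi>(2) obtain b where b: "b \<in> B" "\<phi> {b} = \<phi> {nbr b}" by (auto simp: Z_def)
      with B(1) B(3)[of b] have "b \<in> V n" "nbr b \<in> V n" "nbr b \<noteq> b" "{nbr b, b} \<in> E n" by auto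
      with hamiltonian_lift_if_equal_labels[where x = "nbr b" and y = b, OF tree ori pos] b(2)
      show "\<phi> \<in> A n" unfolding A_def by simp
    qed
    then have "measure_pmf.prob ?M (- Z) \<le> measure_pmf.prob ?M (A n)"
      by (intro measure_pmf.finite_measure_mono_AE) auto
    moreover have "measure_pmf.prob ?M (- Z) = 1 - measure_pmf.prob ?M Z"
      using measure_pmf.prob_compl[of Z ?M] by (simp add: Compl_eq_Diff_UNIV)
    ultimately show ?thesis using Z by linarith
  qed
  have "filterlim (\<lambda>n::nat. n div 2) at_top at_top"
    unfolding filterlim_at_top
  proof
    fix k :: nat
    show "\<forall>\<^sub>F n in sequentially. k \<le> n div 2"
      using eventually_ge_at_top[of "2 * k"] by eventually_elim linarith
  qed
  then have "(\<lambda>n. \<psi> (n div 2)) \<longlonglongrightarrow> 0"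
    using expectation_power_tendsto_0[of P] unfolding \<psi>_def by (rule filterlim_compose[rotated])
  then have lower: "(\<lambda>n. 1 - \<psi> (n div 2)) \<longlonglongrightarrow> 1"
    using tendsto_diff[OF tendsto_const[of 1]] by fastforce
  have "(\<lambda>n. measure_pmf.prob (random_labelling (E n) P) (A n)) \<longlonglongrightarrow> 1"
  proof (rule tendsto_sandwich[OF _ _ lower tendsto_const])
    show "\<forall>\<^sub>F n in sequentially. 1 - \<psi> (n div 2) \<le> measure_pmf.prob (random_labelling (E n) P) (A n)"
      using eventually_ge_at_top[of 2] by eventually_elim (rule bound)
    show "\<forall>\<^sub>F n in sequentially. measure_pmf.prob (random_labelling (E n) P) (A n) \<le> 1"
      by simp
  qed
  then show ?thesis unfolding A_def .
qed

end
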